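(* Let $m$ be a positive integer, let $0<\alpha\le \pi/4$, and let $R(z_1,\ldots,z_m)$ be a rational function of $m$ complex variables such that $$|R(z_1,\ldots,z_m)|\le 1\qquad \text{for all } z_1,\ldots,z_m\in \mathcal{W}(\alpha):=\{z\in\mathbb{C}:\ |\arg(-z)|\le \alpha\}\cup\{0\}.$$ Then there exists a constant $K$ depending only on $\alpha$ and $m$ such that, for all $\beta_1,\ldots,\beta_m>0$, all positive integers $N_1,\ldots,N_m$, all $\tau>0$ and all integers $n\ge 0$, $$\|D^{-1}R(\tau D_1,\tau D_2,\ldots,\tau D_m)^n\|_\infty\le \frac{K}{\hat\beta},\qquad \hat\beta:=\min_{1\le j\le m}\beta_j>0,$$ where $D=\sum_{j=1}^m D_j$ and the matrices $D_j$ (depending on $\beta_j$ and $N_1,\ldots,N_m$) are the discrete diffusion matrices defined in the context.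
   Context: For positive integers $N_1,\ldots,N_m$ set $\Delta x_j=1/(N_j+1)$, let $I_j$ be the identity matrix of dimension $N_j$, and let $L_j=\frac{1}{\Delta x_j^2}\,\mathrm{tridiag}(1,-2,1)$ be the $N_j\times N_j$ tridiagonal matrix with diagonal entries $-2/\Delta x_j^2$ and sub- and superdiagonal entries $1/\Delta x_j^2$. For $\beta_j>0$ define $$D_j=\beta_j\,(I_m\otimes\cdots\otimes I_{j+1}\otimes L_j\otimes I_{j-1}\otimes\cdots\otimes I_1),\qquad D=\sum_{j=1}^m D_j,$$ where $\otimes$ is the Kronecker product. The matrices $D_j$ commute pairwise. $\|\cdot\|_\infty$ denotes the matrix norm induced by the maximum norm on vectors. The hypothesis on $R$ includes that $R$ is defined (its denominator does not vanish) at all points of $\mathcal{W}(\alpha)^m$. $R(\tau D_1,\ldots,\tau D_m)$ is the matrix obtained by substituting the commuting matrices $\tau D_j$ for the variables $z_j$ in $R$ (numerator times the inverse of the denominator). *)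

theory Defs
  imports
    Complex_Main
    "HOL-Library.Poly_Mapping"
    "Jordan_Normal_Form.Matrix"
    "Jordan_Normal_Form.Gauss_Jordan_Elimination"
begin

text \<open>Polynomials in variables indexed by natural numbers: a polynomial maps each monomial
  (an exponent vector of finite support) to its coefficient. A rational function is given by a
  numerator and a denominator.\<close>

type_synonym cmpoly = "(nat \<Rightarrow>\<^sub>0 nat) \<Rightarrow>\<^sub>0 complex"

definition cmpoly_vars :: "cmpoly \<Rightarrow> nat set" where
  "cmpoly_vars p = (\<Union>a\<in>Poly_Mapping.keys p. Poly_Mapping.keys a)"

definition cmpoly_eval :: "(nat \<Rightarrow> complex) \<Rightarrow> cmpoly \<Rightarrow> complex" where
  "cmpoly_eval z p = (\<Sum>a\<in>Poly_Mapping.keys p. Poly_Mapping.lookup p a *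
     (\<Prod>i\<in>Poly_Mapping.keys a. z i ^ Poly_Mapping.lookup a i))"

definition ratfun_eval :: "(nat \<Rightarrow> complex) \<Rightarrow> cmpoly \<Rightarrow> cmpoly \<Rightarrow> complex" where
  "ratfun_eval z P Q = cmpoly_eval z P / cmpoly_eval z Q"

text \<open>Evaluation at square matrices of size \<open>d\<close>. The product of matrix powers is taken in
  increasing order of the variables; it is only meant for pairwise commuting arguments, where the
  order is irrelevant.\<close>

definition finsum_sqmat :: "nat \<Rightarrow> ('c \<Rightarrow> complex mat) \<Rightarrow> 'c set \<Rightarrow> complex mat" where
  "finsum_sqmat d f S = mat d d (\<lambda>(r, s). \<Sum>a\<in>S. f a $$ (r, s))"

definition monomial_eval_mat :: "nat \<Rightarrow> (nat \<Rightarrow> complex mat) \<Rightarrow> (nat \<Rightarrow>\<^sub>0 nat) \<Rightarrow> complex mat" where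
  "monomial_eval_mat d X a =
     foldr (\<lambda>i M. X i ^\<^sub>m Poly_Mapping.lookup a i * M)
       (sorted_list_of_set (Poly_Mapping.keys a)) (1\<^sub>m d)"

definition cmpoly_eval_mat :: "nat \<Rightarrow> (nat \<Rightarrow> complex mat) \<Rightarrow> cmpoly \<Rightarrow> complex mat" where
  "cmpoly_eval_mat d X p =
     finsum_sqmat d (\<lambda>a. Poly_Mapping.lookup p a \<cdot>\<^sub>m monomial_eval_mat d X a) (Poly_Mapping.keys p)"

text \<open>Only meaningful for invertible matrices.\<close>

definition inv_of_mat :: "complex mat \<Rightarrow> complex mat" where
  "inv_of_mat A = the (mat_inverse A)"

definition ratfun_eval_mat :: "nat \<Rightarrow> (nat \<Rightarrow> complex mat) \<Rightarrow> cmpoly \<Rightarrow> cmpoly \<Rightarrow> complex mat" where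
  "ratfun_eval_mat d X P Q = cmpoly_eval_mat d X P * inv_of_mat (cmpoly_eval_mat d X Q)"

definition sector :: "real \<Rightarrow> complex set" where
  "sector \<alpha> = {z. \<bar>Arg (- z)\<bar> \<le> \<alpha>} \<union> {0}"

text \<open>Maximum norm of vectors and the induced matrix norm, for positive dimensions.\<close>

definition max_norm_vec :: "complex vec \<Rightarrow> real" where
  "max_norm_vec v = Max ((\<lambda>i. cmod (v $ i)) ` {..<dim_vec v})"

definition max_norm_mat :: "complex mat \<Rightarrow> real" where
  "max_norm_mat A =
     (SUP v \<in> carrier_vec (dim_col A) - {0\<^sub>v (dim_col A)}. max_norm_vec (A *\<^sub>v v) / max_norm_vec v)"

definition kronecker :: "complex mat \<Rightarrow> complex mat \<Rightarrow> complex mat" where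
  "kronecker A B = mat (dim_row A * dim_row B) (dim_col A * dim_col B)
     (\<lambda>(r, s). A $$ (r div dim_row B, s div dim_col B) * B $$ (r mod dim_row B, s mod dim_col B))"

text \<open>\<open>kronecker_upto F m\<close> is \<open>F m \<otimes> F (m - 1) \<otimes> \<dots> \<otimes> F 1\<close>; the
  one-by-one identity is the neutral element.\<close>

fun kronecker_upto :: "(nat \<Rightarrow> complex mat) \<Rightarrow> nat \<Rightarrow> complex mat" where
  "kronecker_upto F 0 = 1\<^sub>m 1"
| "kronecker_upto F (Suc k) = kronecker (F (Suc k)) (kronecker_upto F k)"

definition mesh_width :: "nat \<Rightarrow> real" where
  "mesh_width N = 1 / (real N + 1)"

definition laplace_1d :: "nat \<Rightarrow> complex mat" where
  "laplace_1d N = mat N N (\<lambda>(r, s).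
     complex_of_real (if r = s then - 2 / (mesh_width N)\<^sup>2
       else if r = Suc s \<or> s = Suc r then 1 / (mesh_width N)\<^sup>2 else 0))"

definition grid_dim :: "nat \<Rightarrow> (nat \<Rightarrow> nat) \<Rightarrow> nat" where
  "grid_dim m N = (\<Prod>j=1..m. N j)"

definition diffusion_dir :: "nat \<Rightarrow> (nat \<Rightarrow> nat) \<Rightarrow> (nat \<Rightarrow> real) \<Rightarrow> nat \<Rightarrow> complex mat" where
  "diffusion_dir m N \<beta> j = complex_of_real (\<beta> j) \<cdot>\<^sub>m
     kronecker_upto (\<lambda>i. if i = j then laplace_1d (N i) else 1\<^sub>m (N i)) m"

definition diffusion :: "nat \<Rightarrow> (nat \<Rightarrow> nat) \<Rightarrow> (nat \<Rightarrow> real) \<Rightarrow> complex mat" where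
  "diffusion m N \<beta> = finsum_sqmat (grid_dim m N) (diffusion_dir m N \<beta>) {1..m}"

end

theory Submission
  imports Defs "HOL-Complex_Analysis.Cauchy_Integral_Formula"
begin

text \<open>
  Write \<open>A\<^sub>j = - D\<^sub>j\<close> and \<open>x\<^sub>j = - z\<^sub>j\<close>, so that all spectra are positive. Tensor products of discrete sines
  diagonalise all \<open>A\<^sub>j\<close> at once, so the matrix in question is \<open>F(A\<^sub>1, \<dots>, A\<^sub>m)\<close> for the symbol
  \<open>F(x) = - R(- \<tau> x)\<^sup>n / (x\<^sub>1 + \<dots> + x\<^sub>m)\<close>. If all \<open>x\<^sub>j\<close> are in the open sector
  \<open>\<bar>Im x\<^sub>j\<bar> < \<sigma> Re x\<^sub>j\<close> with \<open>\<sigma> = tan \<alpha> \<le> 1\<close>, then the power of \<open>R\<close> is at most \<open>1\<close> in modulus, and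
  each \<open>\<bar>x\<^sub>j\<bar>\<close> is at most twice the modulus of the sum. Therefore
  \<open>\<bar>F(x)\<bar> \<le> 2 \<Prod> \<bar>x\<^sub>j\<bar> powr (-1/m)\<close> (\<open>resolvent_symbol_bound\<close>). Only this bound and the fact that \<open>F\<close> is
  holomorphic in each variable matter, so \<open>R\<close>, \<open>n\<close> and \<open>\<tau>\<close> leave the argument here.

  Since the bound is a product, the variables can be treated one after the other
  (\<open>multivariate_kernel_bound\<close>). The spectrum of \<open>A\<^sub>j\<close> is to the right of \<open>\<beta>\<^sub>j\<close>, so Cauchy's formula
  applies on a triangle with vertex \<open>\<beta>\<^sub>j\<close>, sides of slope \<open>\<plusminus>\<sigma>\<close> and a third side to the right of the spectrum.
  It writes \<open>F(A\<^sub>1, \<dots>, A\<^sub>m)\<close> as an integral over \<open>z\<close> of the tensor product of the resolvent of the Laplacian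
  in direction \<open>j\<close> with the matrix obtained by freezing \<open>x\<^sub>j = z\<close>. The first factor has row sums \<open>O(1 / \<bar>z\<bar>)\<close>, the
  second has row sums \<open>O(\<bar>z\<bar> powr (-1/m))\<close> by induction, and the integral of the product is
  \<open>O(\<beta>\<^sub>j powr (-1/m))\<close>, uniformly in the position of the third side (\<open>triangle_cauchy_bound\<close>).
  The product of these powers over \<open>j = 1, \<dots>, m\<close> is at most \<open>1 / min \<beta>\<^sub>j\<close>. Starting the triangle at
  \<open>\<beta>\<^sub>j\<close> rather than at \<open>0\<close> is essential: it keeps \<open>z\<close> away from the singularity of the integrand.

  The resolvent estimate in the maximum norm (\<open>unit_resolvent_bound\<close>) rests on odd periodic extension, which replaces
  the interval by the whole line. There the difference operator \<open>(2 - \<zeta>) - E - E\<^sup>-\<^sup>1\<close>, with the shift \<open>E\<close>, splits into two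
  first-order factors with the contraction rate \<open>w\<close> given by \<open>w + 1 / w = 2 - \<zeta>\<close>, and
  \<open>(1 - \<bar>w\<bar>)\<^sup>2 / \<bar>w\<bar> = (\<bar>\<zeta>\<bar> + \<bar>4 - \<zeta>\<bar> - 4) / 2\<close>. This is comparable with \<open>\<bar>\<zeta>\<bar>\<close> at a positive angle from the
  spectrum and far beyond it; near the vertex of the triangle the discrete maximum principle takes over.
\<close>

section \<open>Cauchy's formula on a triangle inside a sector\<close>

definition wedge :: "real \<Rightarrow> complex set" where
  "wedge \<sigma> = {z. \<bar>Im z\<bar> < \<sigma> * Re z}"

text \<open>The boundary of the triangle with vertex \<open>c\<close>, two sides of slopes \<open>\<plusminus>\<sigma>\<close> and a
  vertical third side on the line \<open>Re z = T\<close>. For \<open>c > 0\<close> it lies in the open wedge.\<close>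

definition triangle_boundary :: "real \<Rightarrow> real \<Rightarrow> real \<Rightarrow> complex set" where
  "triangle_boundary \<sigma> c T = {z. c \<le> Re z \<and> Re z \<le> T \<and> \<bar>Im z\<bar> \<le> \<sigma> * (Re z - c) \<and>
     (\<bar>Im z\<bar> = \<sigma> * (Re z - c) \<or> Re z = T)}"

text \<open>On the segment \<open>cmod z\<close> is at least \<open>Re z\<close>, so the integral is dominated by that of
  \<open>x powr (-1 - a)\<close> over \<open>x \<ge> c\<close>; this is why the bound does not involve \<open>T\<close>.\<close>

lemma slanted_segment_integral_bound:
  fixes c T a B s :: real
  assumes "0 < c" "c < T" "0 < a" "0 \<le> B" "\<bar>s\<bar> \<le> 1"
    and int: "(f has_contour_integral J) (linepath (of_real c) (Complex T (s * (T - c))))"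
    and bound: "\<And>z. z \<in> closed_segment (of_real c) (Complex T (s * (T - c))) \<Longrightarrow> cmod (f z) \<le> B / cmod z powr (1 + a)"
  shows "cmod J \<le> sqrt 2 * B * c powr (-a) / a"
proof -
  define b where "b = Complex T (s * (T - c))"
  define l where "l = linepath (of_real c) b"
  have Rel: "Re (l t) = c + t * (T - c)" for t
    by (simp add: l_def b_def linepath_def algebra_simps)
  have nb: "cmod (b - of_real c) \<le> sqrt 2 * (T - c)"
  proof -
    have "b - of_real c = of_real (T - c) * Complex 1 s"
      by (simp add: b_def complex_eq_iff algebra_simps)
    moreover have "cmod (Complex 1 s) \<le> sqrt 2"
      using assms(5) by (simp add: cmod_def abs_square_le_1)
    ultimately show ?thesis using assms(2)
      by (simp add: norm_mult mult.commute mult_left_mono del: of_real_diff)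
  qed
  define g where "g = (\<lambda>t. sqrt 2 * B * (T - c) * (c + t * (T - c)) powr (- a - 1))"
  define G where "G = (\<lambda>t. - (sqrt 2 * B / a) * (c + t * (T - c)) powr (-a))"
  have pos: "c + t * (T - c) > 0" if "t \<in> {0..1}" for t
    using that assms by (simp add: add_pos_nonneg)
  have g: "(g has_integral (G 1 - G 0)) {0..1}"
  proof (rule fundamental_theorem_of_calculus)
    fix t :: real assume t: "t \<in> {0..1}"
    have "(G has_real_derivative g t) (at t within {0..1})"
      unfolding G_def g_def
      using pos[OF t] assms(3)
      by (auto intro!: derivative_eq_intros simp: field_simps)
    then show "(G has_vector_derivative g t) (at t within {0..1})"
      by (simp add: has_real_derivative_iff_has_vector_derivative)
  qed simp
  have f: "((\<lambda>t. f (l t) * (b - of_real c)) has_integral J) {0..1}"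
    using int by (simp add: has_contour_integral_linepath l_def b_def)
  have "norm (f (l t) * (b - of_real c)) \<le> g t" if t: "t \<in> {0..1}" for t
  proof -
    have "l t \<in> closed_segment (of_real c) b"
      using t unfolding l_def by (simp add: linepath_in_path)
    then have "cmod (f (l t)) \<le> B / cmod (l t) powr (1 + a)"
      using bound b_def by simp
    also have "\<dots> \<le> B / (c + t * (T - c)) powr (1 + a)"
    proof (rule divide_left_mono)
      have "c + t * (T - c) \<le> cmod (l t)" using complex_Re_le_cmod[of "l t"] Rel by simp
      then show "(c + t * (T - c)) powr (1 + a) \<le> cmod (l t) powr (1 + a)"
        using pos[OF t] assms by (intro powr_mono2) auto
      then show "0 < cmod (l t) powr (1 + a) * (c + t * (T - c)) powr (1 + a)"
        using pos[OF t] by (intro mult_pos_pos) (auto simp: less_le_trans)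
    qed (use assms in auto)
    also have "\<dots> = B * (c + t * (T - c)) powr (- a - 1)"
      using powr_minus_divide[of "c + t * (T - c)" "1 + a"] by (metis minus_add_distrib mult.right_neutral times_divide_eq_right uminus_add_conv_diff add.commute)
    finally have 1: "cmod (f (l t)) \<le> B * (c + t * (T - c)) powr (- a - 1)" .
    have "norm (f (l t) * (b - of_real c)) \<le> (B * (c + t * (T - c)) powr (- a - 1)) * (sqrt 2 * (T - c))"
      unfolding norm_mult by (intro mult_mono 1 nb) (use assms in auto)
    then show ?thesis by (simp add: g_def mult_ac)
  qed
  then have "norm (integral {0..1} (\<lambda>t. f (l t) * (b - of_real c))) \<le> integral {0..1} g"
    using f g by (intro integral_norm_bound_integral) auto
  then have "norm J \<le> G 1 - G 0"
    unfolding integral_unique[OF f] integral_unique[OF g] .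
  also have "\<dots> \<le> sqrt 2 * B * c powr (-a) / a"
    using assms by (simp add: G_def)
  finally show ?thesis .
qed

text \<open>The open region cut out by the three sides is contained in the convex hull, by explicit
  barycentric coordinates; hence its real points are interior.\<close>

lemma interior_triangle_real_point:
  fixes \<sigma> c T x :: real
  assumes "0 < \<sigma>" "c < x" "x < T"
  shows "complex_of_real x \<in> interior (convex hull {of_real c, Complex T (- \<sigma> * (T - c)), Complex T (\<sigma> * (T - c))})"
proof (rule interiorI)
  let ?V = "{z. \<bar>Im z\<bar> < \<sigma> * (Re z - c)} \<inter> {z. Re z < T}"
  show "open ?V" by (intro open_Int open_Collect_less continuous_intros)
  show "complex_of_real x \<in> ?V" using assms by simp
  show "?V \<subseteq> convex hull {of_real c, Complex T (- \<sigma> * (T - c)), Complex T (\<sigma> * (T - c))}"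
  proof
    fix z assume z: "z \<in> ?V"
    define p where "p = (Re z - c) / (T - c)"
    define q where "q = Im z / (\<sigma> * (T - c))"
    have Tc: "T - c > 0" using assms by simp
    have zp: "Re z = c + p * (T - c)" using Tc by (simp add: p_def)
    have zq: "Im z = q * (\<sigma> * (T - c))" using Tc assms by (simp add: q_def)
    have "\<bar>q\<bar> * (\<sigma> * (T - c)) < p * (\<sigma> * (T - c))"
      using z Tc assms by (simp add: zp zq abs_mult mult_ac)
    then have pq: "\<bar>q\<bar> < p" 
      using Tc assms by (simp add: mult_less_cancel_right)
    have p1: "p < 1" using z Tc by (simp add: p_def)
    have e: "z = (1 - p) *\<^sub>R complex_of_real c + ((p - q) / 2) *\<^sub>R Complex T (- \<sigma> * (T - c)) + ((p + q) / 2) *\<^sub>R Complex T (\<sigma> * (T - c))"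
      unfolding complex_eq_iff zp zq by (simp add: field_simps)
    have "0 \<le> 1 - p" "0 \<le> (p - q) / 2" "0 \<le> (p + q) / 2" "(1 - p) + (p - q) / 2 + (p + q) / 2 = 1"
      using pq p1 by (auto simp: field_simps)
    with e show "z \<in> convex hull {of_real c, Complex T (- \<sigma> * (T - c)), Complex T (\<sigma> * (T - c))}"
      unfolding convex_hull_3 by blast
  qed
qed

lemma slanted_segment_subset:
  fixes c T s \<sigma> :: real
  assumes "c < T" "\<bar>s\<bar> = \<sigma>"
  shows "closed_segment (of_real c) (Complex T (s * (T - c))) \<subseteq> triangle_boundary \<sigma> c T"
proof
  fix z assume "z \<in> closed_segment (of_real c) (Complex T (s * (T - c)))"
  then obtain u where u: "0 \<le> u" "u \<le> 1" and z: "z = (1 - u) *\<^sub>R of_real c + u *\<^sub>R Complex T (s * (T - c))"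
    by (auto simp: closed_segment_def)
  have "Re z = c + u * (T - c)" "Im z = s * (u * (T - c))"
    by (auto simp: z algebra_simps)
  moreover have "u * (T - c) \<le> 1 * (T - c)" using u assms by (intro mult_right_mono) auto
  moreover have "0 \<le> u * (T - c)" using u assms by simp
  ultimately show "z \<in> triangle_boundary \<sigma> c T"
    using assms(2) u by (simp add: triangle_boundary_def abs_mult)
qed

lemma vertical_segment_subset:
  fixes c T \<sigma> :: real
  assumes "c < T" "0 < \<sigma>"
  shows "closed_segment (Complex T (- \<sigma> * (T - c))) (Complex T (\<sigma> * (T - c))) \<subseteq> triangle_boundary \<sigma> c T"
proof
  fix z assume "z \<in> closed_segment (Complex T (- \<sigma> * (T - c))) (Complex T (\<sigma> * (T - c)))"
  then obtain u where u: "0 \<le> u" "u \<le> 1" and z: "z = (1 - u) *\<^sub>R Complex T (- \<sigma> * (T - c)) + u *\<^sub>R Complex T (\<sigma> * (T - c))"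
    by (auto simp: closed_segment_def)
  have "Re z = T" "Im z = (2 * u - 1) * (\<sigma> * (T - c))"
    by (auto simp: z algebra_simps)
  moreover have "\<bar>2 * u - 1\<bar> * (\<sigma> * (T - c)) \<le> 1 * (\<sigma> * (T - c))" using u assms by (intro mult_right_mono) auto
  ultimately show "z \<in> triangle_boundary \<sigma> c T"
    using assms by (simp add: triangle_boundary_def abs_mult)
qed

lemma triangle_boundary_subset_wedge:
  assumes "0 < c" "0 < \<sigma>"
  shows "triangle_boundary \<sigma> c T \<subseteq> wedge \<sigma>"
proof
  fix z assume "z \<in> triangle_boundary \<sigma> c T"
  then have "\<bar>Im z\<bar> \<le> \<sigma> * (Re z - c)" by (simp add: triangle_boundary_def)
  also have "\<dots> < \<sigma> * Re z" using assms by simp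
  finally show "z \<in> wedge \<sigma>" by (simp add: wedge_def)
qed

lemma open_wedge: "open (wedge \<sigma>)"
  unfolding wedge_def by (intro open_Collect_less continuous_intros)

lemma convex_wedge: "0 < \<sigma> \<Longrightarrow> convex (wedge \<sigma>)"
proof (rule convexI)
  fix x y and u v :: real
  assume s: "0 < \<sigma>" and xy: "x \<in> wedge \<sigma>" "y \<in> wedge \<sigma>" and uv: "0 \<le> u" "0 \<le> v" "u + v = 1"
  have "\<bar>u * Im x + v * Im y\<bar> \<le> u * \<bar>Im x\<bar> + v * \<bar>Im y\<bar>"
    using uv by (metis abs_mult abs_of_nonneg abs_triangle_ineq)
  also have "\<dots> < u * (\<sigma> * Re x) + v * (\<sigma> * Re y)"
  proof (cases "u = 0")
    case True then show ?thesis using uv xy by (simp add: wedge_def)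
  next
    case False
    then have "u * \<bar>Im x\<bar> < u * (\<sigma> * Re x)" using uv xy by (simp add: wedge_def)
    moreover have "v * \<bar>Im y\<bar> \<le> v * (\<sigma> * Re y)" using uv xy by (intro mult_left_mono) (auto simp: wedge_def)
    ultimately show ?thesis by simp
  qed
  finally show "u *\<^sub>R x + v *\<^sub>R y \<in> wedge \<sigma>"
    by (simp add: wedge_def algebra_simps)
qed

text \<open>Several functions are treated together, one for each point \<open>\<mu> k\<close>, because only the sum of the
  Cauchy kernels is small on the boundary: in the application it is an entry of a resolvent, whereas
  the individual terms are not bounded uniformly in the number of points. The decay
  \<open>cmod z powr (-1 - a)\<close> beats the length \<open>2 * \<sigma> * (T - c)\<close> of the vertical side, so that the result is
  uniform in \<open>T\<close>.\<close>

lemma triangle_cauchy_bound: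
  fixes \<psi> :: "'k \<Rightarrow> complex \<Rightarrow> complex" and \<mu> :: "'k \<Rightarrow> real"
  assumes \<sigma>: "0 < \<sigma>" "\<sigma> \<le> 1" and c: "0 < c" "c < T" and a: "0 < a" "a \<le> 1" and "0 \<le> B" and "finite I"
    and \<mu>: "\<And>k. k \<in> I \<Longrightarrow> c < \<mu> k \<and> \<mu> k < T"
    and hol: "\<And>k. k \<in> I \<Longrightarrow> \<psi> k holomorphic_on wedge \<sigma>"
    and bound: "\<And>z. z \<in> triangle_boundary \<sigma> c T \<Longrightarrow>
      cmod (\<Sum>k\<in>I. \<psi> k z / (z - of_real (\<mu> k))) \<le> B / cmod z powr (1 + a)"
  shows "cmod (\<Sum>k\<in>I. \<psi> k (of_real (\<mu> k))) \<le> B * c powr (-a) / a"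
proof -
  define p where "p = complex_of_real c"
  define q where "q = Complex T (- \<sigma> * (T - c))"
  define r where "r = Complex T (\<sigma> * (T - c))"
  define \<gamma> where "\<gamma> = linepath p q +++ linepath q r +++ linepath r p"
  define f where "f = (\<lambda>z. \<Sum>k\<in>I. \<psi> k z / (z - of_real (\<mu> k)))"
  have pq: "closed_segment p q \<subseteq> triangle_boundary \<sigma> c T"
    unfolding p_def q_def by (rule slanted_segment_subset) (use \<sigma> c in auto)
  have pr: "closed_segment p r \<subseteq> triangle_boundary \<sigma> c T"
    unfolding p_def r_def by (rule slanted_segment_subset) (use \<sigma> c in auto)
  have qr: "closed_segment q r \<subseteq> triangle_boundary \<sigma> c T"
    unfolding q_def r_def by (rule vertical_segment_subset) (use \<sigma> c in auto)
  have img: "path_image \<gamma> \<subseteq> triangle_boundary \<sigma> c T"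
    using pq qr pr by (auto simp: \<gamma>_def path_image_join closed_segment_commute)
  have off: "of_real (\<mu> k) \<notin> triangle_boundary \<sigma> c T" if "k \<in> I" for k
    using \<mu>[OF that] \<sigma> by (auto simp: triangle_boundary_def)
  have total: "(f has_contour_integral (\<Sum>k\<in>I. 2 * pi * \<i> * \<psi> k (of_real (\<mu> k)))) \<gamma>"
    unfolding f_def
  proof (rule has_contour_integral_sum[OF \<open>finite I\<close>])
    fix k assume k: "k \<in> I"
    have "winding_number \<gamma> (of_real (\<mu> k)) = 1"
    proof -
      have "of_real (\<mu> k) \<in> interior (convex hull {p, q, r})"
        unfolding p_def q_def r_def by (rule interior_triangle_real_point) (use \<mu>[OF k] \<sigma> in auto)
      moreover have "0 < Im ((q - p) * cnj (q - of_real (\<mu> k)))"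
      proof -
        have "Im ((q - p) * cnj (q - of_real (\<mu> k))) = \<sigma> * ((T - c) * (\<mu> k - c))"
          by (simp add: p_def q_def algebra_simps)
        then show ?thesis using \<mu>[OF k] \<sigma> c by simp
      qed
      ultimately show ?thesis
        unfolding \<gamma>_def using winding_number_triangle[of "of_real (\<mu> k)" p q r] by simp
    qed
    moreover have "((\<lambda>w. \<psi> k w / (w - of_real (\<mu> k))) has_contour_integral
       (2 * pi * \<i> * winding_number \<gamma> (of_real (\<mu> k)) * \<psi> k (of_real (\<mu> k)))) \<gamma>"
    proof (rule Cauchy_integral_formula_convex_simple[OF convex_wedge hol[OF k]])
      show "of_real (\<mu> k) \<in> interior (wedge \<sigma>)"
        using \<mu>[OF k] c \<sigma> by (simp add: interior_open open_wedge) (simp add: wedge_def)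
      show "path_image \<gamma> \<subseteq> wedge \<sigma> - {of_real (\<mu> k)}"
        using img off[OF k] triangle_boundary_subset_wedge[OF c(1) \<sigma>(1), of T] by blast
    qed (use \<sigma> in \<open>auto simp: \<gamma>_def\<close>)
    ultimately show "((\<lambda>w. \<psi> k w / (w - of_real (\<mu> k))) has_contour_integral
       (2 * pi * \<i> * \<psi> k (of_real (\<mu> k)))) \<gamma>" by simp
  qed
  have cont: "continuous_on (triangle_boundary \<sigma> c T) f"
    unfolding f_def
  proof (intro continuous_intros)
    fix k assume k: "k \<in> I"
    show "continuous_on (triangle_boundary \<sigma> c T) (\<psi> k)"
      using hol[OF k] triangle_boundary_subset_wedge[OF c(1) \<sigma>(1), of T]
      by (meson continuous_on_subset holomorphic_on_imp_continuous_on)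
  qed (use off in auto)
  have integ: "f contour_integrable_on linepath u v" if "closed_segment u v \<subseteq> triangle_boundary \<sigma> c T" for u v
    using cont that by (intro contour_integrable_continuous_linepath) (rule continuous_on_subset)
  define J where "J = (\<lambda>u v. contour_integral (linepath u v) f)"
  have J: "(f has_contour_integral J u v) (linepath u v)" if "closed_segment u v \<subseteq> triangle_boundary \<sigma> c T" for u v
    unfolding J_def by (rule has_contour_integral_integral[OF integ[OF that]])
  have "(f has_contour_integral (J p q + (J q r + J r p))) \<gamma>"
    unfolding \<gamma>_def by (intro has_contour_integral_join J) (use pq qr pr in \<open>auto simp: closed_segment_commute\<close>)
  from has_contour_integral_unique[OF total this]
  have "(\<Sum>k\<in>I. 2 * pi * \<i> * \<psi> k (of_real (\<mu> k))) = J p q + (J q r + J r p)" .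
  moreover have "J r p = - J p r"
    unfolding J_def by (subst contour_integral_reverse_linepath) (use cont pr in \<open>auto intro: continuous_on_subset simp: closed_segment_commute\<close>)
  ultimately have eq: "(\<Sum>k\<in>I. 2 * pi * \<i> * \<psi> k (of_real (\<mu> k))) = J p q + (J q r - J p r)"
    by simp
  have Jpq: "cmod (J p q) \<le> sqrt 2 * B * c powr (-a) / a"
    by (rule slanted_segment_integral_bound[of c T a B "-\<sigma>" f])
      (use J[OF pq] pq bound f_def \<sigma> c a \<open>0 \<le> B\<close> in \<open>auto simp: p_def q_def\<close>)
  have Jpr: "cmod (J p r) \<le> sqrt 2 * B * c powr (-a) / a"
    by (rule slanted_segment_integral_bound[of c T a B "\<sigma>" f])
      (use J[OF pr] pr bound f_def \<sigma> c a \<open>0 \<le> B\<close> in \<open>auto simp: p_def r_def\<close>)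
  have Jqr: "cmod (J q r) \<le> 2 * B * c powr (-a)"
  proof -
    have "cmod (J q r) \<le> (B / T powr (1 + a)) * cmod (r - q)"
    proof (rule has_contour_integral_bound_linepath[OF J[OF qr]])
      fix z assume z: "z \<in> closed_segment q r"
      then obtain u where zu: "z = (1 - u) *\<^sub>R q + u *\<^sub>R r" by (auto simp: closed_segment_def)
      have "Re z = T" unfolding zu by (simp add: q_def r_def algebra_simps)
      then have "T \<le> cmod z" using complex_Re_le_cmod[of z] by simp
      then have "B / cmod z powr (1 + a) \<le> B / T powr (1 + a)"
        using c a \<open>0 \<le> B\<close> by (intro divide_left_mono powr_mono2 mult_pos_pos) auto
      then show "cmod (f z) \<le> B / T powr (1 + a)"
        using bound[of z] z qr f_def by force
    qed (use \<open>0 \<le> B\<close> in auto)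
    also have "cmod (r - q) = 2 * \<sigma> * (T - c)"
    proof -
      have "r - q = \<i> * of_real (2 * \<sigma> * (T - c))" by (simp add: r_def q_def complex_eq_iff)
      then show ?thesis using \<sigma> c by (simp add: norm_mult del: of_real_mult)
    qed
    also have "(B / T powr (1 + a)) * (2 * \<sigma> * (T - c)) \<le> (B / T powr (1 + a)) * (2 * 1 * T)"
      using \<sigma> c \<open>0 \<le> B\<close> by (intro mult_left_mono mult_mono) auto
    also have "\<dots> = 2 * B * T powr (-a)" using c by (simp add: powr_add powr_minus field_simps)
    also have "\<dots> \<le> 2 * B * c powr (-a)" using c a \<open>0 \<le> B\<close> by (intro mult_left_mono powr_mono2') auto
    finally show ?thesis .
  qed
  have "2 * pi * cmod (\<Sum>k\<in>I. \<psi> k (of_real (\<mu> k))) = cmod (\<Sum>k\<in>I. 2 * pi * \<i> * \<psi> k (of_real (\<mu> k)))"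
    by (simp add: sum_distrib_left[symmetric] norm_mult)
  also have "\<dots> \<le> cmod (J p q) + (cmod (J q r) + cmod (J p r))"
    unfolding eq by (meson norm_triangle_ineq norm_triangle_ineq4 order_trans add_left_mono)
  also have "\<dots> \<le> (2 * sqrt 2 + 2 * a) * (B * c powr (-a) / a)"
  proof -
    define X where "X = B * c powr (-a) / a"
    have "cmod (J p q) \<le> sqrt 2 * X" "cmod (J p r) \<le> sqrt 2 * X" "cmod (J q r) \<le> 2 * (a * X)"
      using Jpq Jpr Jqr a by (simp_all add: X_def mult_ac)
    then show ?thesis unfolding X_def[symmetric] by (simp add: algebra_simps)
  qed
  also have "\<dots> \<le> (2 * pi) * (B * c powr (-a) / a)"
  proof (rule mult_right_mono)
    have "sqrt 2 \<le> 2" by (simp add: real_sqrt_le_iff[of 2 4, simplified])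
    then show "2 * sqrt 2 + 2 * a \<le> 2 * pi" using a pi_gt3 by linarith
  qed (use a \<open>0 \<le> B\<close> in auto)
  finally show ?thesis by (rule mult_left_le_imp_le) simp
qed


section \<open>Discrete sines\<close>

text \<open>The eigenvectors of the Dirichlet Laplacian on \<open>N\<close> inner grid points, which are numbered from \<open>1\<close> here;
  the mode \<open>k\<close> counts from \<open>0\<close>. The position is an arbitrary integer because the odd periodic extension
  to the whole line is needed later. The mesh width is \<open>1 / (N + 1)\<close>.\<close>

definition sine :: "nat \<Rightarrow> int \<Rightarrow> nat \<Rightarrow> real" where
  "sine N r k = sin (pi * of_int r * real (k + 1) / real (N + 1))"

text \<open>Eigenvalues of \<open>- laplace_1d N\<close>, hence positive.\<close>

definition lap_eig :: "nat \<Rightarrow> nat \<Rightarrow> real" where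
  "lap_eig N k = 2 * (real (N + 1))\<^sup>2 * (1 - cos (pi * real (k + 1) / real (N + 1)))"

lemma sine_commute: "sine N (int r + 1) k = sine N (int k + 1) r"
  by (simp add: sine_def mult_ac add_ac)

lemma second_difference_sine:
  "(real (N + 1))\<^sup>2 * (2 * sine N r k - sine N (r + 1) k - sine N (r - 1) k) = lap_eig N k * sine N r k"
proof -
  define \<theta> where "\<theta> = pi * real (k + 1) / real (N + 1)"
  have s: "sine N r k = sin (of_int r * \<theta>)" for r
    by (simp add: sine_def \<theta>_def mult_ac)
  have e: "sine N (r + 1) k + sine N (r - 1) k = 2 * cos \<theta> * sine N r k"
    by (simp add: s algebra_simps sin_add sin_diff)
  have "2 * sine N r k - sine N (r + 1) k - sine N (r - 1) k = 2 * (1 - cos \<theta>) * sine N r k"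
    using e by (simp add: algebra_simps)
  then show ?thesis by (simp add: lap_eig_def \<theta>_def)
qed

lemma sine_reflect: "sine N (2 * (int N + 1) - r) k = - sine N r k"
  and sine_periodic: "sine N (r + 2 * (int N + 1) * j) k = sine N r k"
  and sine_0 [simp]: "sine N 0 k = 0"
  and sine_end [simp]: "sine N (int N + 1) k = 0"
proof -
  define \<theta> where "\<theta> = pi * real (k + 1) / real (N + 1)"
  have s: "sine N r k = sin (of_int r * \<theta>)" for r
    by (simp add: sine_def \<theta>_def mult_ac)
  have t: "(real N + 1) * \<theta> = pi * real (k + 1)"
    by (simp add: \<theta>_def field_simps)
  show "sine N 0 k = 0" by (simp add: s)
  show "sine N (int N + 1) k = 0" 
    unfolding s using sin_npi2[of "k + 1"] by (simp only: of_int_add of_int_of_nat_eq of_int_1 t)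
  have p: "sine N (r + 2 * (int N + 1) * j) k = sine N r k" for r j
  proof -
    have "of_int (r + 2 * (int N + 1) * j) * \<theta> = of_int r * \<theta> + 2 * of_int j * ((real N + 1) * \<theta>)"
      by (simp add: algebra_simps)
    also have "\<dots> = of_int r * \<theta> + 2 * pi * of_int (j * int (k + 1))"
      unfolding t by simp
    finally show ?thesis unfolding s
      by (simp only: sin_add sin_int_2pin cos_int_2pin mult_1_right mult_zero_right add_0_right)
  qed
  show "sine N (r + 2 * (int N + 1) * j) k = sine N r k" by (rule p)
  have "sine N (2 * (int N + 1) - r) k = sine N (- r + 2 * (int N + 1) * 1) k" by (simp add: algebra_simps)
  also have "\<dots> = sine N (- r) k" by (rule p)
  finally show "sine N (2 * (int N + 1) - r) k = - sine N r k" by (simp add: s)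
qed

text \<open>Multiplying by \<open>2 * sin (x / 2)\<close> makes the sum telescope.\<close>

lemma sum_cos_multiples:
  assumes "sin (x / 2) \<noteq> 0"
  shows "(\<Sum>k<n. cos (real k * x)) = (sin ((real n - 1 / 2) * x) / sin (x / 2) + 1) / 2"
proof -
  have "(\<Sum>k<n. 2 * sin (x / 2) * cos (real k * x)) = sin ((real n - 1 / 2) * x) + sin (x / 2)"
  proof (induction n)
    case (Suc n)
    have "sin ((real (Suc n) - 1 / 2) * x) = sin (real n * x + x / 2)"
      "sin ((real n - 1 / 2) * x) = sin (real n * x - x / 2)"
      by (simp_all add: algebra_simps)
    then have "sin ((real (Suc n) - 1 / 2) * x) - sin ((real n - 1 / 2) * x) = 2 * sin (x / 2) * cos (real n * x)"
      by (simp add: sin_add sin_diff)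
    with Suc show ?case by simp
  qed simp
  then have "2 * sin (x / 2) * (\<Sum>k<n. cos (real k * x)) = sin ((real n - 1 / 2) * x) + sin (x / 2)"
    by (simp add: sum_distrib_left)
  with assms show ?thesis by (simp add: field_simps)
qed

lemma sum_cos_grid:
  fixes j :: int
  assumes "0 < \<bar>j\<bar>" "\<bar>j\<bar> < 2 * int M"
  shows "(\<Sum>k<M. cos (real k * (pi * of_int j / real M))) = (1 - cos (pi * of_int j)) / 2"
proof -
  define x where "x = pi * of_int j / real M"
  have M: "M > 0" using assms by (cases M) auto
  have nz: "sin (x / 2) \<noteq> 0"
  proof
    assume "sin (x / 2) = 0"
    then obtain i :: int where "x / 2 = of_int i * pi" by (auto simp: sin_zero_iff_int2)
    then have "real_of_int j = real_of_int (2 * i * int M)" using M by (simp add: x_def field_simps)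
    then have "j = 2 * i * int M" by (simp only: of_int_eq_iff)
    then have "2 * int M dvd j" by simp
    with assms show False using zdvd_imp_le[of "2 * int M" "\<bar>j\<bar>"] by simp
  qed
  have "(real M - 1 / 2) * x = pi * of_int j - x / 2" using M by (simp add: x_def field_simps)
  then have "sin ((real M - 1 / 2) * x) = - cos (pi * of_int j) * sin (x / 2)"
    by (simp add: sin_diff)
  then have "sin ((real M - 1 / 2) * x) / sin (x / 2) = - cos (pi * of_int j)" using nz by simp
  with sum_cos_multiples[OF nz, of M] show ?thesis unfolding x_def[symmetric] by simp
qed

text \<open>The product of two sines is a difference of cosines of the frequencies \<open>r - s\<close> and \<open>r + s + 2\<close>. These have
  the same parity, so for \<open>r \<noteq> s\<close> the two cosine sums agree and cancel.\<close>

lemma sine_orthogonal: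
  assumes "r < N" "s < N"
  shows "(\<Sum>k<N. sine N (int r + 1) k * sine N (int s + 1) k) = (if r = s then (real N + 1) / 2 else 0)"
proof -
  define M where "M = N + 1"
  define f where "f = (\<lambda>k. sin (pi * (real r + 1) * real k / real M) * sin (pi * (real s + 1) * real k / real M))"
  define c where "c = (\<lambda>j::int. \<Sum>k<M. cos (real k * (pi * of_int j / real M)))"
  have "(\<Sum>k<N. sine N (int r + 1) k * sine N (int s + 1) k) = (\<Sum>k<N. f (Suc k))"
    by (simp add: sine_def f_def M_def algebra_simps)
  also have "\<dots> = (\<Sum>k<M. f k)"
    by (simp only: M_def Suc_eq_plus1[symmetric] sum.lessThan_Suc_shift) (simp add: f_def)
  also have "\<dots> = (c (int r - int s) - c (int r + int s + 2)) / 2"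
  proof -
    have "f k = (cos (real k * (pi * of_int (int r - int s) / real M)) - cos (real k * (pi * of_int (int r + int s + 2) / real M))) / 2" for k
    proof -
      have "real k * (pi * of_int (int r - int s) / real M) = pi * (real r + 1) * real k / real M - pi * (real s + 1) * real k / real M"
        "real k * (pi * of_int (int r + int s + 2) / real M) = pi * (real r + 1) * real k / real M + pi * (real s + 1) * real k / real M"
        by (simp_all add: algebra_simps add_divide_distrib diff_divide_distrib)
      then show ?thesis by (simp add: f_def cos_diff cos_add)
    qed
    then have "sum f {..<M} = (\<Sum>k<M. (cos (real k * (pi * of_int (int r - int s) / real M)) - cos (real k * (pi * of_int (int r + int s + 2) / real M))) / 2)"
      by (rule sum.cong[OF refl])
    then show ?thesis by (simp only: c_def sum_subtractf sum_divide_distrib[symmetric])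
  qed
  also have "\<dots> = (if r = s then (real N + 1) / 2 else 0)"
  proof -
    have 2: "c (int r + int s + 2) = (1 - cos (pi * of_int (int r + int s + 2))) / 2"
      unfolding c_def by (rule sum_cos_grid) (use assms in \<open>auto simp: M_def\<close>)
    have per: "cos (pi * of_int (int r + int s + 2)) = cos (pi * of_int (int r - int s))"
    proof -
      have "pi * of_int (int r + int s + 2) = pi * of_int (int r - int s) + 2 * pi * of_int (int s + 1)"
        by (simp add: algebra_simps)
      then show ?thesis by (simp only: cos_add sin_int_2pin cos_int_2pin mult_1_right mult_zero_right diff_0_right)
    qed
    show ?thesis
    proof (cases "r = s")
      case True
      then show ?thesis using 2 per by (simp add: c_def M_def)
    next
      case False
      have "c (int r - int s) = (1 - cos (pi * of_int (int r - int s))) / 2"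
        unfolding c_def by (rule sum_cos_grid) (use assms False in \<open>auto simp: M_def\<close>)
      with False 2 per show ?thesis by simp
    qed
  qed
  finally show ?thesis .
qed

section \<open>Resolvent of the one-dimensional Laplacian in the maximum norm\<close>

text \<open>The discrete maximum principle: at the leftmost point where a positive maximum is attained, the
  value would exceed the mean of its neighbours.\<close>

lemma convex_sequence_nonpos:
  fixes v :: "nat \<Rightarrow> real"
  assumes "v 0 \<le> 0" "v M \<le> 0" and conv: "\<And>r. 0 < r \<Longrightarrow> r < M \<Longrightarrow> 2 * v r \<le> v (r - 1) + v (r + 1)"
    and "r \<le> M"
  shows "v r \<le> 0"
proof (rule ccontr)
  assume "\<not> v r \<le> 0"
  define V where "V = Max (v ` {..M})"
  have le: "v s \<le> V" if "s \<le> M" for s using that by (simp add: V_def)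
  have "V > 0" using \<open>\<not> v r \<le> 0\<close> le[OF \<open>r \<le> M\<close>] by simp
  have "V \<in> v ` {..M}" unfolding V_def by (rule Max_in) auto
  then have ex: "\<exists>s. s \<le> M \<and> v s = V" by auto
  define s where "s = (LEAST s. s \<le> M \<and> v s = V)"
  have s: "s \<le> M" "v s = V" using LeastI_ex[OF ex] by (auto simp: s_def)
  have "v s \<noteq> v 0" "v s \<noteq> v M" using s(2) \<open>V > 0\<close> assms(1,2) by linarith+
  then have "s \<noteq> 0" "s \<noteq> M" by metis+
  then have s0: "0 < s" "s < M" using s(1) by simp_all
  have "v (s - 1) \<noteq> V"
  proof
    assume "v (s - 1) = V"
    moreover have "s - 1 \<le> M" using s by simp
    ultimately have "s \<le> s - 1"
      using Least_le[of "\<lambda>s. s \<le> M \<and> v s = V" "s - 1"] unfolding s_def[symmetric] by simp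
    then show False using s0 by simp
  qed
  moreover have "v (s - 1) \<le> V" "v (s + 1) \<le> V" using s0 by (auto intro: le)
  ultimately show False using conv[OF s0] s(2) by linarith
qed

text \<open>The inverse of the Dirichlet Laplacian has maximum norm at most \<open>1/8\<close>. By the triangle inequality
  \<open>cmod (u r)\<close> is a subsolution, so it is dominated by the parabola \<open>x * (1 - x) / 2\<close> times \<open>G\<close>, which
  solves the equation with constant right-hand side \<open>G\<close>.\<close>

lemma discrete_poisson_bound:
  fixes u :: "nat \<Rightarrow> complex"
  assumes "u 0 = 0" "u M = 0" "0 \<le> G" "0 < M"
    and eq: "\<And>r. 0 < r \<Longrightarrow> r < M \<Longrightarrow> (real M)\<^sup>2 * cmod (2 * u r - u (r + 1) - u (r - 1)) \<le> G"
    and "r \<le> M"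
  shows "cmod (u r) \<le> G / 8"
proof -
  define e where "e = (\<lambda>r. G / (2 * (real M)\<^sup>2) * (real r * (real M - real r)))"
  have "cmod (u r) - e r \<le> 0"
  proof (rule convex_sequence_nonpos[of "\<lambda>r. cmod (u r) - e r" M r])
    fix r assume r: "0 < r" "r < M"
    have "2 * u r = u (r - 1) + u (r + 1) + (2 * u r - u (r + 1) - u (r - 1))" by simp
    then have "cmod (2 * u r) \<le> cmod (u (r - 1) + u (r + 1)) + cmod (2 * u r - u (r + 1) - u (r - 1))"
      by (metis norm_triangle_ineq)
    also have "\<dots> \<le> cmod (u (r - 1)) + cmod (u (r + 1)) + G / (real M)\<^sup>2"
    proof (rule add_mono)
      show "cmod (2 * u r - u (r + 1) - u (r - 1)) \<le> G / (real M)\<^sup>2"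
        using eq[OF r] \<open>0 < M\<close> by (simp add: pos_le_divide_eq mult.commute)
    qed (rule norm_triangle_ineq)
    finally have 1: "2 * cmod (u r) \<le> cmod (u (r - 1)) + cmod (u (r + 1)) + G / (real M)\<^sup>2"
      by (simp add: norm_mult)
    have "2 * e r = e (r - 1) + e (r + 1) + G / (real M)\<^sup>2"
    proof -
      define K where "K = G / (2 * (real M)\<^sup>2)"
      have K: "G / (real M)\<^sup>2 = 2 * K" by (simp add: K_def)
      show ?thesis unfolding e_def K_def[symmetric] K using r by (simp add: of_nat_diff algebra_simps)
    qed
    with 1 show "2 * (cmod (u r) - e r) \<le> cmod (u (r - 1)) - e (r - 1) + (cmod (u (r + 1)) - e (r + 1))"
      by simp
  qed (use assms in \<open>auto simp: e_def\<close>)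
  moreover have "e r \<le> G / 8"
  proof -
    have "0 \<le> (real M - 2 * real r)\<^sup>2" by simp
    then have "real r * (real M - real r) \<le> (real M)\<^sup>2 / 4"
      by (simp add: power2_eq_square algebra_simps)
    then have "e r \<le> G / (2 * (real M)\<^sup>2) * ((real M)\<^sup>2 / 4)"
      unfolding e_def using \<open>0 \<le> G\<close> by (intro mult_left_mono) auto
    then show ?thesis using \<open>0 < M\<close> by simp
  qed
  ultimately show ?thesis by simp
qed

text \<open>An eigenvector solves the Poisson problem with its eigenvalue times itself on the right, so the
  bound \<open>1/8\<close> for the inverse forces the eigenvalue to be at least \<open>8\<close>, uniformly in the grid.\<close>

lemma lap_eig_ge: "k < N \<Longrightarrow> 8 \<le> lap_eig N k"
proof -
  assume k: "k < N"
  have nn: "0 \<le> lap_eig N k" by (simp add: lap_eig_def)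
  define U where "U = Max ((\<lambda>r. \<bar>sine N (int r) k\<bar>) ` {..N + 1})"
  have U: "\<bar>sine N (int r) k\<bar> \<le> U" if "r \<le> N + 1" for r unfolding U_def using that by (intro Max_ge) auto
  have "U \<in> (\<lambda>r. \<bar>sine N (int r) k\<bar>) ` {..N + 1}" unfolding U_def by (rule Max_in) auto
  then obtain r where r: "r \<le> N + 1" "\<bar>sine N (int r) k\<bar> = U" by auto
  have "cmod (of_real (sine N (int r) k)) \<le> (lap_eig N k * U) / 8"
  proof (rule discrete_poisson_bound[of "\<lambda>r. of_real (sine N (int r) k)" "N + 1"])
    fix r assume r: "0 < r" "r < N + 1"
    have "(real (N + 1))\<^sup>2 * cmod (2 * of_real (sine N (int r) k) - of_real (sine N (int (r + 1)) k) - of_real (sine N (int (r - 1)) k))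
      = \<bar>(real (N + 1))\<^sup>2 * (2 * sine N (int r) k - sine N (int r + 1) k - sine N (int r - 1) k)\<bar>"
    proof -
      have i: "int (r + 1) = int r + 1" "int (r - 1) = int r - 1" using r by auto
      have "cmod (2 * of_real (sine N (int r) k) - of_real (sine N (int r + 1) k) - of_real (sine N (int r - 1) k))
        = cmod (of_real (2 * sine N (int r) k - sine N (int r + 1) k - sine N (int r - 1) k))"
        by simp
      then show ?thesis unfolding i norm_of_real by (simp only: abs_mult abs_power2)
    qed
    also have "\<dots> = lap_eig N k * \<bar>sine N (int r) k\<bar>" 
      unfolding second_difference_sine using nn by (simp add: abs_mult)
    also have "\<dots> \<le> lap_eig N k * U" using U[of r] r nn by (intro mult_left_mono) auto
    finally show "(real (N + 1))\<^sup>2 * cmod (2 * of_real (sine N (int r) k) - of_real (sine N (int (r + 1)) k) - of_real (sine N (int (r - 1)) k)) \<le> lap_eig N k * U" .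
  next
    show "complex_of_real (sine N (int (N + 1)) k) = 0" by (simp only: of_nat_add of_nat_1 sine_end of_real_0)
  qed (use r nn U[of 0] in auto)
  then have "U \<le> (lap_eig N k / 8) * U" using r by simp
  moreover have "U > 0"
  proof -
    have "sine N 1 k > 0" unfolding sine_def
  proof (rule sin_gt_zero)
    show "0 < pi * of_int 1 * real (k + 1) / real (N + 1)" by (intro divide_pos_pos mult_pos_pos) auto
    show "pi * of_int 1 * real (k + 1) / real (N + 1) < pi" using k by (simp add: divide_less_eq)
  qed
    with U[of 1] show ?thesis by simp
  qed
  ultimately show ?thesis by simp
qed

lemma lap_eig_le: "lap_eig N k \<le> 4 * (real (N + 1))\<^sup>2"
proof -
  have "1 - cos (pi * real (k + 1) / real (N + 1)) \<le> 2" using cos_ge_minus_one[of "pi * real (k + 1) / real (N + 1)"] by linarith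
  then have "2 * (real (N + 1))\<^sup>2 * (1 - cos (pi * real (k + 1) / real (N + 1))) \<le> 2 * (real (N + 1))\<^sup>2 * 2"
    by (intro mult_left_mono) auto
  then show ?thesis unfolding lap_eig_def by (simp only: )
qed

text \<open>The operator \<open>1 - w * E\<close> is inverted by a geometric series on bounded families, for any substitution
  \<open>E\<close> of the index.\<close>

lemma first_order_recurrence_bound:
  fixes x y :: "'i \<Rightarrow> complex"
  assumes "cmod w < 1" "\<And>r. cmod (x r) \<le> C" and step: "\<And>r. cmod (x r - w * x (f r)) \<le> G"
  shows "(1 - cmod w) * cmod (x r) \<le> G"
proof -
  define V where "V = (SUP r. cmod (x r))"
  have bdd: "bdd_above (range (\<lambda>r. cmod (x r)))" using assms(2) by (intro bdd_aboveI[of _ C]) auto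
  have le: "cmod (x r) \<le> V" for r unfolding V_def by (rule cSUP_upper[OF _ bdd]) simp
  have "cmod (x r) \<le> G + cmod w * V" for r
  proof -
    have "cmod (x r) \<le> cmod (x r - w * x (f r)) + cmod (w * x (f r))"
      by (metis diff_add_cancel norm_triangle_ineq)
    also have "\<dots> \<le> G + cmod w * V" unfolding norm_mult by (intro add_mono step mult_left_mono le) auto
    finally show ?thesis .
  qed
  then have "V \<le> G + cmod w * V" unfolding V_def by (intro cSUP_least) auto
  then have "(1 - cmod w) * V \<le> G" by (simp add: algebra_simps)
  moreover have "(1 - cmod w) * cmod (x r) \<le> (1 - cmod w) * V" using assms(1) le by (intro mult_left_mono) auto
  ultimately show ?thesis by simp
qed

text \<open>Of the two roots of \<open>w + 1 / w = 2 - \<zeta>\<close> one is in the unit disc. The last equation follows from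
  \<open>(1 - w)\<^sup>2 = - \<zeta> * w\<close>, \<open>(1 + w)\<^sup>2 = (4 - \<zeta>) * w\<close> and the parallelogram law; it expresses the distance of
  \<open>w\<close> from the unit circle through the ellipse with foci \<open>0\<close> and \<open>4\<close> that contains \<open>\<zeta>\<close>.\<close>

lemma joukowsky_preimage:
  fixes \<zeta> :: complex
  assumes "cmod \<zeta> + cmod (4 - \<zeta>) > 4"
  obtains w where "w \<noteq> 0" "cmod w < 1" "w\<^sup>2 + 1 = (2 - \<zeta>) * w"
    "2 * (1 - cmod w)\<^sup>2 = cmod w * (cmod \<zeta> + cmod (4 - \<zeta>) - 4)"
proof -
  define d where "d = csqrt ((2 - \<zeta>)\<^sup>2 - 4)"
  have d2: "d\<^sup>2 = (2 - \<zeta>)\<^sup>2 - 4" by (simp add: d_def)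
  define v1 where "v1 = ((2 - \<zeta>) + d) / 2"
  define v2 where "v2 = ((2 - \<zeta>) - d) / 2"
  have e1: "d = 2 * v1 - (2 - \<zeta>)" and e2: "d = (2 - \<zeta>) - 2 * v2" by (simp_all add: v1_def v2_def field_simps)
  have "4 * (v1\<^sup>2 + 1) = 4 * ((2 - \<zeta>) * v1)"
    using d2 unfolding e1 by (simp add: power2_eq_square algebra_simps)
  then have r1: "v1\<^sup>2 + 1 = (2 - \<zeta>) * v1" by (simp only: mult_cancel_left) simp
  have "4 * (v2\<^sup>2 + 1) = 4 * ((2 - \<zeta>) * v2)"
    using d2 unfolding e2 by (simp add: power2_eq_square algebra_simps)
  then have r2: "v2\<^sup>2 + 1 = (2 - \<zeta>) * v2" by (simp only: mult_cancel_left) simp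
  have v2: "v2 = (2 - \<zeta>) - v1" by (simp add: v1_def v2_def field_simps)
  have "v1 * v2 = 1" unfolding v2 using r1 by (simp add: power2_eq_square algebra_simps)
  then have "cmod v1 * cmod v2 = 1" by (metis norm_mult norm_one)
  then have "cmod v1 \<le> 1 \<or> cmod v2 \<le> 1"
    by (metis linorder_not_le mult_less_cancel_left1 norm_ge_zero order_less_trans less_1_mult less_irrefl)
  then obtain w where w1: "cmod w \<le> 1" and w: "w\<^sup>2 + 1 = (2 - \<zeta>) * w"
    using r1 r2 by blast
  have w0: "w \<noteq> 0" using w by auto
  have "- (\<zeta> * w) = (1 - w)\<^sup>2" "(4 - \<zeta>) * w = (1 + w)\<^sup>2" using w by (simp_all add: power2_eq_square algebra_simps)
  then have "cmod \<zeta> * cmod w = (cmod (1 - w))\<^sup>2" "cmod (4 - \<zeta>) * cmod w = (cmod (1 + w))\<^sup>2"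
    by (metis norm_minus_cancel norm_mult norm_power)+
  moreover have "(cmod (1 - w))\<^sup>2 + (cmod (1 + w))\<^sup>2 = 2 + 2 * (cmod w)\<^sup>2"
    unfolding cmod_power2 by (simp add: power2_eq_square algebra_simps)
  ultimately have id: "2 * (1 - cmod w)\<^sup>2 = cmod w * (cmod \<zeta> + cmod (4 - \<zeta>) - 4)"
    by (simp add: power2_eq_square algebra_simps)
  moreover have "cmod w * (cmod \<zeta> + cmod (4 - \<zeta>) - 4) > 0" using w0 assms by simp
  ultimately have "cmod w \<noteq> 1" by auto
  with that w0 w1 w id show ?thesis by simp
qed

text \<open>With \<open>E\<close> the shift by one and \<open>w + 1 / w = 2 - \<zeta>\<close>, the operator \<open>(2 - \<zeta>) - E - E\<^sup>-\<^sup>1\<close> factors as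
  \<open>(1 - w * E) * (1 - w * E\<^sup>-\<^sup>1) / w\<close>, and each factor is bounded below by \<open>1 - cmod w\<close>.\<close>

lemma whole_line_resolvent_bound:
  fixes u :: "int \<Rightarrow> complex"
  assumes "\<And>r. cmod (u r) \<le> C"
    and eq: "\<And>r. cmod ((2 - \<zeta>) * u r - u (r + 1) - u (r - 1)) \<le> G"
  shows "(cmod \<zeta> + cmod (4 - \<zeta>) - 4) * cmod (u r) \<le> 2 * G"
proof (cases "cmod \<zeta> + cmod (4 - \<zeta>) > 4")
  case False
  moreover have "0 \<le> G" using eq norm_ge_zero order_trans by blast
  ultimately show ?thesis by (smt (verit) mult_nonpos_nonneg norm_ge_zero)
next
  case True
  then obtain w where w: "w \<noteq> 0" "cmod w < 1" "w\<^sup>2 + 1 = (2 - \<zeta>) * w"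
    and id: "2 * (1 - cmod w)\<^sup>2 = cmod w * (cmod \<zeta> + cmod (4 - \<zeta>) - 4)"
    by (rule joukowsky_preimage)
  define v where "v = (\<lambda>r. u r - w * u (r - 1))"
  have v: "cmod (v r - w * v (r + 1)) \<le> cmod w * G" for r
  proof -
    have "v r - w * v (r + 1) = (w\<^sup>2 + 1) * u r - w * (u (r + 1) + u (r - 1))"
      by (simp add: v_def power2_eq_square algebra_simps)
    also have "\<dots> = w * ((2 - \<zeta>) * u r - u (r + 1) - u (r - 1))"
      unfolding w by (simp add: algebra_simps)
    finally show ?thesis using eq[of r] by (simp add: norm_mult mult_left_mono)
  qed
  have vb: "cmod (v r) \<le> C + cmod w * C" for r
    unfolding v_def by (rule order_trans[OF norm_triangle_ineq4]) (auto simp: norm_mult intro!: add_mono mult_left_mono assms)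
  have "cmod (v r) \<le> cmod w * G / (1 - cmod w)" for r
    using first_order_recurrence_bound[of w v "C + cmod w * C" "\<lambda>r. r + 1" "cmod w * G" r] vb v w(2) by (simp add: field_simps)
  then have "(1 - cmod w) * cmod (u r) \<le> cmod w * G / (1 - cmod w)"
    using first_order_recurrence_bound[of w u C "\<lambda>r. r - 1" "cmod w * G / (1 - cmod w)" r] w(2) assms(1) unfolding v_def by blast
  then have "(1 - cmod w)\<^sup>2 * cmod (u r) \<le> cmod w * G" using w(2) by (simp add: field_simps power2_eq_square)
  then have "(2 * (1 - cmod w)\<^sup>2) * cmod (u r) \<le> cmod w * (2 * G)" by simp
  then have "cmod w * ((cmod \<zeta> + cmod (4 - \<zeta>) - 4) * cmod (u r)) \<le> cmod w * (2 * G)" unfolding id by (simp only: mult_ac)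
  then show ?thesis using w(1) by simp
qed

text \<open>A grid function given by its coefficients in the sine basis. As a function on all integers it is the
  odd periodic extension, for which the difference equation holds everywhere and the boundary
  disappears.\<close>

definition sine_poly :: "nat \<Rightarrow> (nat \<Rightarrow> complex) \<Rightarrow> int \<Rightarrow> complex" where
  "sine_poly N a r = (\<Sum>k<N. a k * of_real (sine N r k))"

lemma second_difference_sine_poly:
  "of_real ((real (N + 1))\<^sup>2) * (2 * sine_poly N a r - sine_poly N a (r + 1) - sine_poly N a (r - 1)) =
   sine_poly N (\<lambda>k. of_real (lap_eig N k) * a k) r"
proof -
  have "of_real ((real (N + 1))\<^sup>2) * (2 * sine_poly N a r - sine_poly N a (r + 1) - sine_poly N a (r - 1)) =
    (\<Sum>k<N. a k * of_real ((real (N + 1))\<^sup>2 * (2 * sine N r k - sine N (r + 1) k - sine N (r - 1) k)))"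
    unfolding sine_poly_def
    by (simp add: sum_distrib_left sum_subtractf[symmetric] right_diff_distrib[symmetric] mult_ac del: of_real_power)
  also have "\<dots> = sine_poly N (\<lambda>k. of_real (lap_eig N k) * a k) r"
    unfolding second_difference_sine sine_poly_def by (simp add: mult_ac)
  finally show ?thesis .
qed

lemma sine_poly_bound_everywhere:
  assumes "0 \<le> G" "\<And>s. s < N \<Longrightarrow> cmod (sine_poly N a (int s + 1)) \<le> G"
  shows "cmod (sine_poly N a r) \<le> G"
proof -
  define P where "P = 2 * (int N + 1)"
  define t where "t = r mod P"
  have P: "P > 0" by (simp add: P_def)
  then have t: "0 \<le> t" "t < P" by (simp_all add: t_def)
  have "r = t + P * (r div P)" by (simp add: t_def)
  then have rt: "sine_poly N a r = sine_poly N a t"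
    unfolding sine_poly_def by (metis P_def sine_periodic)
  have half: "cmod (sine_poly N a x) \<le> G" if "0 \<le> x" "x \<le> int N + 1" for x
  proof (cases "x = 0 \<or> x = int N + 1")
    case True then show ?thesis using assms(1) by (auto simp: sine_poly_def)
  next
    case False
    then have "x = int (nat (x - 1)) + 1" "nat (x - 1) < N" using that by auto
    then show ?thesis using assms(2) by metis
  qed
  show ?thesis
  proof (cases "t \<le> int N + 1")
    case True then show ?thesis using half t rt by simp
  next
    case False
    have "sine_poly N a (P - t) = - sine_poly N a t"
      by (simp only: sine_poly_def P_def sine_reflect of_real_minus mult_minus_right sum_negf)
    moreover have "cmod (sine_poly N a (P - t)) \<le> G" using False t by (intro half) (auto simp: P_def)
    ultimately show ?thesis using rt by simp
  qed
qed

text \<open>This is the estimate \<open>O(1 / cmod z)\<close> for the resolvent, in the sine basis. Three arguments cover the boundary of the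
  triangle. Near the vertex \<open>1\<close> the resolvent is a perturbation of the inverse Laplacian, as \<open>cmod z / 8 \<le> 1/2\<close>. On the
  far side the point \<open>\<zeta> = z / (N + 1)\<^sup>2\<close> is beyond the spectrum, which lies in \<open>[0, 4]\<close> on this scale. On the slanted
  sides away from the vertex, \<open>cmod \<zeta> + cmod (4 - \<zeta>) - 4 \<ge> cmod \<zeta> - Re \<zeta>\<close>, and the right-hand side is
  comparable with \<open>cmod \<zeta>\<close> since the argument of \<open>\<zeta>\<close> stays away from \<open>0\<close>.\<close>

lemma unit_resolvent_bound:
  fixes a :: "nat \<Rightarrow> complex"
  assumes \<sigma>: "0 < \<sigma>" "\<sigma> \<le> 1" and T: "8 * (real (N + 1))\<^sup>2 \<le> T" and z: "z \<in> triangle_boundary \<sigma> 1 T" and "0 \<le> G"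
    and g: "\<And>s. s < N \<Longrightarrow> cmod (sine_poly N (\<lambda>k. (of_real (lap_eig N k) - z) * a k) (int s + 1)) \<le> G"
  shows "cmod z * cmod (sine_poly N a r) \<le> 64 / \<sigma>\<^sup>2 * G"
proof -
  define u where "u = sine_poly N a"
  define h2 where "h2 = (real (N + 1))\<^sup>2"
  have h2: "h2 > 0" by (simp add: h2_def)
  have G: "cmod (sine_poly N (\<lambda>k. (of_real (lap_eig N k) - z) * a k) r) \<le> G" for r
    by (rule sine_poly_bound_everywhere[OF \<open>0 \<le> G\<close> g])
  have eq: "of_real h2 * (2 * u r - u (r + 1) - u (r - 1)) - z * u r = sine_poly N (\<lambda>k. (of_real (lap_eig N k) - z) * a k) r" for r
    unfolding u_def h2_def second_difference_sine_poly by (simp add: sine_poly_def sum_distrib_left left_diff_distrib right_diff_distrib sum_subtractf mult_ac)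
  have x1: "1 \<le> Re z" and edge: "\<bar>Im z\<bar> = \<sigma> * (Re z - 1) \<or> Re z = T"
    using z by (auto simp: triangle_boundary_def)
  have ubd: "cmod (u r) \<le> (\<Sum>k<N. cmod (a k))" for r
    unfolding u_def sine_poly_def by (rule sum_norm_le) (simp add: norm_mult sine_def mult_left_le)
  define \<zeta> where "\<zeta> = z / of_real h2"
  have line: "(cmod \<zeta> + cmod (4 - \<zeta>) - 4) * cmod (u r) \<le> 2 * (G / h2)" for r
  proof (rule whole_line_resolvent_bound[OF ubd])
    fix r
    have "(2 - \<zeta>) * u r - u (r + 1) - u (r - 1) = (of_real h2 * (2 * u r - u (r + 1) - u (r - 1)) - z * u r) / of_real h2"
      using h2 by (simp add: \<zeta>_def field_simps)
    then show "cmod ((2 - \<zeta>) * u r - u (r + 1) - u (r - 1)) \<le> G / h2"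
      unfolding eq using G[of r] h2 by (simp add: norm_divide divide_right_mono)
  qed
  have \<zeta>z: "cmod \<zeta> = cmod z / h2" "Re \<zeta> = Re z / h2" using h2 by (simp_all add: \<zeta>_def norm_divide)
  have c1: "1 \<le> 64 / \<sigma>\<^sup>2" using \<sigma> power_le_one[of \<sigma> 2] by (simp add: field_simps)
  have c2: "2 \<le> 64 / \<sigma>\<^sup>2" using \<sigma> power_le_one[of \<sigma> 2] by (simp add: field_simps)
  consider "cmod z \<le> 4" | "Re z = T" | "cmod z > 4" "\<bar>Im z\<bar> = \<sigma> * (Re z - 1)" using edge by linarith
  then have "cmod z * cmod (u r) \<le> 64 / \<sigma>\<^sup>2 * G"
  proof cases
    case 1
    \<comment> \<open>Near the vertex: absorb \<open>z * u\<close> into the right-hand side of the Poisson problem.\<close>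
    define U where "U = Max ((\<lambda>s. cmod (u (int s))) ` {..N + 1})"
    have U: "cmod (u (int s)) \<le> U" if "s \<le> N + 1" for s unfolding U_def using that by (intro Max_ge) auto
    have "U \<in> (\<lambda>s. cmod (u (int s))) ` {..N + 1}" unfolding U_def by (rule Max_in) auto
    then obtain s where s: "s \<le> N + 1" "cmod (u (int s)) = U" by auto
    have U0: "0 \<le> U" using s by (metis norm_ge_zero)
    have "cmod (u (int s)) \<le> (G + cmod z * U) / 8"
    proof (rule discrete_poisson_bound[of "\<lambda>s. u (int s)" "N + 1"])
      fix q assume q: "0 < q" "q < N + 1"
      have "of_real h2 * (2 * u (int q) - u (int q + 1) - u (int q - 1)) = sine_poly N (\<lambda>k. (of_real (lap_eig N k) - z) * a k) (int q) + z * u (int q)"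
        using eq[of "int q"] by (simp add: algebra_simps)
      then have "cmod (of_real h2 * (2 * u (int q) - u (int q + 1) - u (int q - 1))) \<le> G + cmod z * U"
        using G[of "int q"] U[of q] q by (auto intro!: norm_triangle_le add_mono mult_left_mono simp: norm_mult)
      then show "(real (N + 1))\<^sup>2 * cmod (2 * u (int q) - u (int (q + 1)) - u (int (q - 1))) \<le> G + cmod z * U"
      proof -
        have i: "int (q + 1) = int q + 1" "int (q - 1) = int q - 1" using q by auto
        assume "cmod (of_real h2 * (2 * u (int q) - u (int q + 1) - u (int q - 1))) \<le> G + cmod z * U"
        then show ?thesis unfolding norm_mult norm_of_real i h2_def[symmetric] using h2 by simp
      qed
    next
      have "int (N + 1) = int N + 1" by simp
    then show "u (int (N + 1)) = 0" by (simp only: u_def sine_poly_def sine_end of_real_0 mult_zero_right sum.neutral_const)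
    qed (use s U0 \<open>0 \<le> G\<close> in \<open>auto simp: u_def sine_poly_def\<close>)
    then have "8 * U \<le> G + cmod z * U" using s by simp
    also have "cmod z * U \<le> 4 * U" using 1 U0 by (intro mult_right_mono)
    finally have U4: "4 * U \<le> G" by simp
    have "cmod (u r) \<le> U" unfolding u_def
    proof (rule sine_poly_bound_everywhere[OF U0])
      fix s assume "s < N"
      then show "cmod (sine_poly N a (int s + 1)) \<le> U" using U[of "Suc s"] by (simp add: u_def add.commute)
    qed
    then have "cmod z * cmod (u r) \<le> 4 * U" using 1 U0 by (intro mult_mono) auto
    also have "\<dots> \<le> 1 * G" using U4 by simp
    also have "\<dots> \<le> 64 / \<sigma>\<^sup>2 * G" using c1 \<open>0 \<le> G\<close> by (intro mult_right_mono)
    finally show ?thesis .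
  next
    case 2
    have "8 * h2 \<le> cmod z" using T 2 complex_Re_le_cmod[of z] by (simp add: h2_def)
    then have 8: "8 \<le> cmod \<zeta>" using h2 by (simp add: \<zeta>z field_simps)
    have "cmod \<zeta> \<le> cmod (4 - \<zeta>) + 4" using norm_triangle_ineq2[of \<zeta> 4] by (simp add: norm_minus_commute)
    then have "cmod \<zeta> \<le> cmod \<zeta> + cmod (4 - \<zeta>) - 4" using 8 by simp
    then have "cmod \<zeta> * cmod (u r) \<le> 2 * (G / h2)" using line[of r] by (meson mult_right_mono norm_ge_zero order_trans)
    then have "cmod z * cmod (u r) \<le> 2 * G" using h2 by (simp add: \<zeta>z field_simps)
    also have "\<dots> \<le> 64 / \<sigma>\<^sup>2 * G" using c2 \<open>0 \<le> G\<close> by (intro mult_right_mono)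
    finally show ?thesis .
  next
    case 3
    have "cmod z \<le> \<bar>Re z\<bar> + \<bar>Im z\<bar>" by (rule cmod_le)
    also have "\<bar>Im z\<bar> \<le> 1 * Re z" unfolding 3(2) using \<sigma> x1 by (intro mult_mono) auto
    finally have cx: "cmod z \<le> 2 * Re z" using x1 by simp
    then have x2: "Re z \<ge> 2" using 3 by simp
    have "\<sigma> * (Re z / 2) \<le> \<bar>Im z\<bar>" unfolding 3(2) using x2 \<sigma> by (intro mult_left_mono) auto
    moreover have "\<sigma> * (cmod z / 4) \<le> \<sigma> * (Re z / 2)" using cx \<sigma> by (intro mult_left_mono) auto
    ultimately have "(\<sigma> * (cmod z / 4))\<^sup>2 \<le> (Im z)\<^sup>2"
      using \<sigma> by (metis abs_ge_zero abs_le_square_iff abs_of_nonneg divide_nonneg_pos mult_nonneg_nonneg norm_ge_zero order_trans less_imp_le zero_less_numeral)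
    also have "\<dots> = (cmod z - Re z) * (cmod z + Re z)"
      by (simp add: cmod_def algebra_simps power2_eq_square[symmetric])
    also have "\<dots> \<le> (cmod z - Re z) * (2 * cmod z)"
      using complex_Re_le_cmod[of z] by (intro mult_left_mono) auto
    finally have "cmod z * (\<sigma>\<^sup>2 / 16 * cmod z) \<le> cmod z * (2 * (cmod z - Re z))"
      by (simp add: power2_eq_square algebra_simps)
    then have "\<sigma>\<^sup>2 / 16 * cmod z \<le> 2 * (cmod z - Re z)"
      by (rule mult_left_le_imp_le) (use 3(1) in linarith)
    then have A: "\<sigma>\<^sup>2 / 32 * cmod z \<le> cmod z - Re z" by simp
    have "4 - Re \<zeta> \<le> cmod (4 - \<zeta>)" using complex_Re_le_cmod[of "4 - \<zeta>"] by simp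
    then have B: "cmod \<zeta> - Re \<zeta> \<le> cmod \<zeta> + cmod (4 - \<zeta>) - 4" by simp
    have "(cmod z - Re z) / h2 = cmod \<zeta> - Re \<zeta>" by (simp add: \<zeta>z diff_divide_distrib)
    then have "(cmod z - Re z) / h2 * cmod (u r) \<le> 2 * (G / h2)" using line[of r] B by (metis (no_types, opaque_lifting) mult_right_mono norm_ge_zero order_trans)
    then have "((cmod z - Re z) * cmod (u r)) / h2 \<le> (2 * G) / h2" by simp
    then have "(cmod z - Re z) * cmod (u r) \<le> 2 * G" using h2 by (simp add: divide_le_cancel)
    moreover have "\<sigma>\<^sup>2 / 32 * cmod z * cmod (u r) \<le> (cmod z - Re z) * cmod (u r)" by (rule mult_right_mono[OF A]) simp
    ultimately have "\<sigma>\<^sup>2 / 32 * cmod z * cmod (u r) \<le> 2 * G" by simp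
    then show ?thesis using \<sigma> by (simp add: field_simps)
  qed
  then show ?thesis by (simp add: u_def)
qed

text \<open>The absolute row sum of the resolvent is attained on a unimodular grid function; this reduces it to the
  previous lemma, after scaling by \<open>\<beta>\<close>. The factor \<open>(N + 1) / 2\<close> is the squared length of the
  sine vectors, which are not normalised.\<close>

lemma resolvent_kernel_bound:
  assumes \<sigma>: "0 < \<sigma>" "\<sigma> \<le> 1" and \<beta>: "0 < \<beta>" and T: "8 * (real (N + 1))\<^sup>2 * \<beta> \<le> T"
    and z: "z \<in> triangle_boundary \<sigma> \<beta> T" and r: "r < N"
    and off: "\<And>k. k < N \<Longrightarrow> z \<noteq> of_real (\<beta> * lap_eig N k)"
  shows "cmod z * (\<Sum>s<N. cmod (\<Sum>k<N. of_real (sine N (int r + 1) k * sine N (int k + 1) s) / (z - of_real (\<beta> * lap_eig N k))))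
    \<le> 64 / \<sigma>\<^sup>2 * ((real N + 1) / 2)"
proof -
  define \<rho> where "\<rho> = (\<lambda>s. \<Sum>k<N. of_real (sine N (int r + 1) k * sine N (int k + 1) s) / (z - of_real (\<beta> * lap_eig N k)))"
  define e where "e = (\<lambda>s. cnj (sgn (\<rho> s)))"
  have e: "e s * \<rho> s = of_real (cmod (\<rho> s))" "cmod (e s) \<le> 1" for s
    by (auto simp: e_def sgn_eq norm_divide complex_norm_square[symmetric] mult.commute power2_eq_square field_simps)
  define a where "a = (\<lambda>k. (\<Sum>s<N. e s * of_real (sine N (int k + 1) s)) / (of_real \<beta> * of_real (lap_eig N k) - z))"
  define y where "y = z / of_real \<beta>"
  have zy: "z = of_real \<beta> * y" using \<beta> by (simp add: y_def)
  have y: "y \<in> triangle_boundary \<sigma> 1 (T / \<beta>)"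
  proof -
    define R where "R = T / \<beta>"
    have "Re z = \<beta> * Re y" "Im z = \<beta> * Im y" "T = \<beta> * R" using \<beta> by (simp_all add: zy R_def)
    moreover have "\<sigma> * (\<beta> * Re y - \<beta>) = \<beta> * (\<sigma> * (Re y - 1))" by (simp add: algebra_simps)
    moreover have "\<beta> * 1 \<le> Re z" using z by (simp add: triangle_boundary_def)
    ultimately have "\<beta> * 1 \<le> \<beta> * Re y" "\<beta> * Re y \<le> \<beta> * R" "\<beta> * \<bar>Im y\<bar> \<le> \<beta> * (\<sigma> * (Re y - 1))"
      "\<beta> * \<bar>Im y\<bar> = \<beta> * (\<sigma> * (Re y - 1)) \<or> \<beta> * Re y = \<beta> * R"
      using z \<beta> by (auto simp only: triangle_boundary_def mem_Collect_eq abs_mult abs_of_pos)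
    then show ?thesis using \<beta> unfolding mult_le_cancel_left_pos[OF \<beta>]
      by (simp add: triangle_boundary_def R_def[symmetric])
  qed
  have sum: "sine_poly N a (int r + 1) = - of_real (\<Sum>s<N. cmod (\<rho> s))"
  proof -
    have "sine_poly N a (int r + 1) = (\<Sum>k<N. \<Sum>s<N. e s * (of_real (sine N (int r + 1) k * sine N (int k + 1) s) / (of_real (\<beta> * lap_eig N k) - z)))"
      by (simp add: sine_poly_def a_def sum_distrib_left sum_distrib_right sum_divide_distrib mult_ac)
    also have "\<dots> = (\<Sum>s<N. \<Sum>k<N. e s * (of_real (sine N (int r + 1) k * sine N (int k + 1) s) / (of_real (\<beta> * lap_eig N k) - z)))"
      by (rule sum.swap)
    also have "\<dots> = (\<Sum>s<N. - (e s * \<rho> s))"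
      unfolding \<rho>_def sum_distrib_left sum_negf[symmetric]
      by (intro sum.cong refl) (metis minus_diff_eq mult_minus_right minus_divide_right)
    finally show ?thesis by (simp add: e sum_negf)
  qed
  have "cmod y * cmod (sine_poly N a (int r + 1)) \<le> 64 / \<sigma>\<^sup>2 * ((real N + 1) / 2 / \<beta>)"
  proof (rule unit_resolvent_bound[OF \<sigma> _ y])
    fix s assume s: "s < N"
    have "(of_real (lap_eig N k) - y) * a k = (\<Sum>s<N. e s * of_real (sine N (int k + 1) s)) / of_real \<beta>" if "k < N" for k
      using off[OF that] \<beta> unfolding a_def zy by (simp add: right_diff_distrib[symmetric])
    then have "sine_poly N (\<lambda>k. (of_real (lap_eig N k) - y) * a k) (int s + 1) =
        (\<Sum>k<N. \<Sum>q<N. e q * of_real (sine N (int s + 1) k * sine N (int q + 1) k) / of_real \<beta>)"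
      unfolding sine_poly_def
      by (intro sum.cong refl) (simp add: sum_distrib_left sum_distrib_right sum_divide_distrib mult_ac sine_commute[of N s] sine_commute[of N k for k])
    also have "\<dots> = (\<Sum>q<N. \<Sum>k<N. e q * of_real (sine N (int s + 1) k * sine N (int q + 1) k) / of_real \<beta>)"
      by (rule sum.swap)
    also have "\<dots> = (\<Sum>q<N. e q * of_real (\<Sum>k<N. sine N (int s + 1) k * sine N (int q + 1) k) / of_real \<beta>)"
      by (simp add: sum_distrib_left sum_divide_distrib)
    also have "\<dots> = (\<Sum>q<N. if s = q then e q * of_real ((real N + 1) / 2) / of_real \<beta> else 0)"
      by (intro sum.cong refl) (simp add: sine_orthogonal s)
    also have "\<dots> = e s * of_real ((real N + 1) / 2 / \<beta>)" using s by simp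
    finally show "cmod (sine_poly N (\<lambda>k. (of_real (lap_eig N k) - y) * a k) (int s + 1)) \<le> (real N + 1) / 2 / \<beta>"
      using e(2)[of s] \<beta> by (simp only: norm_mult norm_of_real) (simp add: divide_right_mono mult_left_le_one_le)
  qed (use \<beta> T in \<open>auto simp: field_simps\<close>)
  moreover have "cmod (sine_poly N a (int r + 1)) = (\<Sum>s<N. cmod (\<rho> s))"
    unfolding sum norm_minus_cancel norm_of_real by (simp add: sum_nonneg)
  moreover have "cmod z = \<beta> * cmod y" using \<beta> by (simp add: zy norm_mult)
  ultimately have "cmod z * (\<Sum>s<N. cmod (\<rho> s)) \<le> \<beta> * (64 / \<sigma>\<^sup>2 * ((real N + 1) / 2 / \<beta>))"
    using \<beta> by (simp only: mult.assoc mult_le_cancel_left_pos)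
  also have "\<dots> = 64 / \<sigma>\<^sup>2 * ((real N + 1) / 2)" using \<beta> by simp
  finally show ?thesis unfolding \<rho>_def .
qed


section \<open>Functions of several commuting Laplacians\<close>

lemma grid_dim_0 [simp]: "grid_dim 0 N = 1"
  and grid_dim_Suc [simp]: "grid_dim (Suc m) N = N (Suc m) * grid_dim m N"
  by (simp_all add: grid_dim_def prod.nat_ivl_Suc' mult.commute)

lemma sum_div_mod:
  "(\<Sum>k<n * d. g (k div d) (k mod d)) = (\<Sum>i<n. \<Sum>j<(d::nat). g i j)"
proof (cases "d = 0")
  case False
  have "i * d + j < n * d" if "i < n" "j < d" for i j
  proof -
    have "i * d + j < Suc i * d" using that by simp
    also have "\<dots> \<le> n * d" using that by (intro mult_right_mono) auto
    finally show ?thesis .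
  qed
  moreover have "k div d < n" if "k < n * d" for k using that False by (simp add: less_mult_imp_div_less)
  ultimately show ?thesis unfolding sum.cartesian_product
    by (intro sum.reindex_bij_witness[of _ "\<lambda>(i, j). i * d + j" "\<lambda>k. (k div d, k mod d)"])
      (use False in auto)
qed simp

text \<open>Entries of the Kronecker product of the sine matrices of directions \<open>m, \<dots>, 1\<close>. Following
  \<^const>\<open>kronecker_upto\<close>, the last direction is the slowest, hence the \<open>div\<close> and \<open>mod\<close>. Both arguments count from
  \<open>0\<close>.\<close>

fun tensor_sine :: "(nat \<Rightarrow> nat) \<Rightarrow> nat \<Rightarrow> nat \<Rightarrow> nat \<Rightarrow> real" where
  "tensor_sine N 0 r k = 1"
| "tensor_sine N (Suc m) r k =
     sine (N (Suc m)) (int (r div grid_dim m N) + 1) (k div grid_dim m N)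
       * tensor_sine N m (r mod grid_dim m N) (k mod grid_dim m N)"

text \<open>The joint eigenvalue of the negative diffusion matrices on the \<open>k\<close>-th tensor product of sines.
  Coordinates outside \<open>{1..m}\<close> are set to \<open>0\<close>.\<close>

fun spectral_point :: "(nat \<Rightarrow> nat) \<Rightarrow> (nat \<Rightarrow> real) \<Rightarrow> nat \<Rightarrow> nat \<Rightarrow> nat \<Rightarrow> complex" where
  "spectral_point N \<beta> 0 k = (\<lambda>_. 0)"
| "spectral_point N \<beta> (Suc m) k = (spectral_point N \<beta> m (k mod grid_dim m N))
     (Suc m := of_real (\<beta> (Suc m) * lap_eig (N (Suc m)) (k div grid_dim m N)))"

text \<open>The squared length of the tensor products of sines.\<close>

definition mode_weight :: "(nat \<Rightarrow> nat) \<Rightarrow> nat \<Rightarrow> real" where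
  "mode_weight N m = (\<Prod>j=1..m. (real (N j) + 1) / 2)"

lemma spectral_point_pos:
  assumes "k < grid_dim m N" "j \<in> {1..m}" "\<And>j. j \<in> {1..m} \<Longrightarrow> 0 < \<beta> j"
  shows "\<exists>x>0. spectral_point N \<beta> m k j = of_real x"
  using assms
proof (induction m arbitrary: k)
  case (Suc m)
  then have d: "k mod grid_dim m N < grid_dim m N" "k div grid_dim m N < N (Suc m)"
    by (auto simp: less_mult_imp_div_less intro!: mod_less_divisor gr0I)
  show ?case
  proof (cases "j = Suc m")
    case True
    have "0 < \<beta> (Suc m) * lap_eig (N (Suc m)) (k div grid_dim m N)"
      using Suc.prems(3)[of "Suc m"] lap_eig_ge[OF d(2)] by simp
    then show ?thesis using True by (auto simp del: of_real_mult)
  next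
    case False
    then show ?thesis using Suc.IH[OF d(1)] Suc.prems by auto
  qed
qed simp

lemma spectral_point_wedge:
  assumes "k < grid_dim m N" "j \<in> {1..m}" "\<And>j. j \<in> {1..m} \<Longrightarrow> 0 < \<beta> j" "0 < \<sigma>"
  shows "spectral_point N \<beta> m k j \<in> wedge \<sigma>"
  using spectral_point_pos[of k m N j \<beta>] assms by (auto simp: wedge_def)

text \<open>The functions \<open>H s\<close> play the role of the entries of a row of a matrix-valued function \<open>H\<close>. Up to normalisation
  the left-hand side is a row sum for \<open>H\<close> applied to one Laplacian,
  that is for the contour integral of the resolvent tensored with \<open>H\<close>; row sums of tensor products
  multiply. To avoid integrating absolute values of all entries separately, the entries are first combined with
  unimodular factors into a single contour integral.\<close>

lemma tensor_resolvent_step: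
  fixes H :: "'s \<Rightarrow> complex \<Rightarrow> complex"
  assumes \<sigma>: "0 < \<sigma>" "\<sigma> \<le> 1" and a: "0 < a" "a \<le> 1" and \<beta>: "0 < \<beta>" and r: "r < n" and "0 \<le> A" "finite I"
    and hol: "\<And>s. s \<in> I \<Longrightarrow> H s holomorphic_on wedge \<sigma>"
    and bound: "\<And>z. z \<in> wedge \<sigma> \<Longrightarrow> (\<Sum>s\<in>I. cmod (H s z)) \<le> A * cmod z powr (-a)"
  shows "(\<Sum>q<n. \<Sum>s\<in>I. cmod (\<Sum>k<n. of_real (sine n (int r + 1) k * sine n (int k + 1) q) * H s (of_real (\<beta> * lap_eig n k))))
    \<le> A * (64 / (\<sigma>\<^sup>2 * a) * \<beta> powr (-a)) * ((real n + 1) / 2)"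
proof -
  define \<mu> where "\<mu> = (\<lambda>k. \<beta> * lap_eig n k)"
  define S where "S = (\<lambda>k q. complex_of_real (sine n (int r + 1) k * sine n (int k + 1) q))"
  define V where "V = (\<lambda>q s. \<Sum>k<n. S k q * H s (of_real (\<mu> k)))"
  define e where "e = (\<lambda>q s. cnj (sgn (V q s)))"
  have e: "e q s * V q s = of_real (cmod (V q s))" "cmod (e q s) \<le> 1" for q s
    by (auto simp: e_def sgn_eq norm_divide complex_norm_square[symmetric] mult.commute power2_eq_square field_simps)
  \<comment> \<open>Twice the upper bound for the spectrum, so that the resolvent is \<open>O(1 / T)\<close> on the far side.\<close>
  define T where "T = 8 * (real (n + 1))\<^sup>2 * \<beta>"
  define \<psi> where "\<psi> = (\<lambda>k z. \<Sum>q<n. \<Sum>s\<in>I. e q s * S k q * H s z)"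
  define B where "B = 64 / \<sigma>\<^sup>2 * ((real n + 1) / 2) * A"
  have B0: "0 \<le> B" using \<open>0 \<le> A\<close> by (simp add: B_def)
  have \<mu>: "\<beta> < \<mu> k \<and> \<mu> k < T" if "k < n" for k
  proof
    have "\<beta> * 1 < \<beta> * lap_eig n k" using lap_eig_ge[OF that] \<beta> by (intro mult_strict_left_mono) auto
    then show "\<beta> < \<mu> k" by (simp add: \<mu>_def)
    have "\<beta> * lap_eig n k \<le> \<beta> * (4 * (real (n + 1))\<^sup>2)" using lap_eig_le \<beta> by (intro mult_left_mono) auto
    also have "\<dots> < T" using \<beta> by (simp add: T_def)
    finally show "\<mu> k < T" by (simp add: \<mu>_def)
  qed
  have "cmod (\<Sum>k<n. \<psi> k (of_real (\<mu> k))) \<le> B * \<beta> powr (-a) / a"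
  proof (rule triangle_cauchy_bound[OF \<sigma> \<beta> _ a B0 _ \<mu>])
    show "\<beta> < T" using \<mu>[of r] r by simp
    show "\<psi> k holomorphic_on wedge \<sigma>" if "k \<in> {..<n}" for k
      unfolding \<psi>_def by (intro holomorphic_intros hol)
    fix z assume z: "z \<in> triangle_boundary \<sigma> \<beta> T"
    define \<rho> where "\<rho> = (\<lambda>q. \<Sum>k<n. S k q / (z - of_real (\<mu> k)))"
    have zw: "z \<in> wedge \<sigma>" using z triangle_boundary_subset_wedge[OF \<beta> \<sigma>(1)] by blast
    then have z0: "cmod z > 0" by (auto simp: wedge_def)
    have "z \<noteq> of_real (\<mu> k)" if "k < n" for k
      using z \<mu>[OF that] \<sigma> by (auto simp: triangle_boundary_def)
    then have \<rho>: "cmod z * (\<Sum>q<n. cmod (\<rho> q)) \<le> 64 / \<sigma>\<^sup>2 * ((real n + 1) / 2)"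
      unfolding \<rho>_def S_def \<mu>_def using z r \<sigma> \<beta> by (intro resolvent_kernel_bound) (auto simp: T_def)
    have "(\<Sum>k<n. \<psi> k z / (z - of_real (\<mu> k))) = (\<Sum>q<n. \<Sum>s\<in>I. e q s * \<rho> q * H s z)"
      unfolding \<psi>_def \<rho>_def sum_divide_distrib sum_distrib_left sum_distrib_right
      by (subst sum.swap, rule sum.cong[OF refl], subst sum.swap) (simp add: mult_ac)
    also have "cmod \<dots> \<le> (\<Sum>q<n. \<Sum>s\<in>I. cmod (\<rho> q) * cmod (H s z))"
      by (intro sum_norm_le) (simp add: norm_mult mult.assoc mult_left_le_one_le e)
    also have "\<dots> = (\<Sum>q<n. cmod (\<rho> q)) * (\<Sum>s\<in>I. cmod (H s z))"
      by (simp add: sum_product)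
    also have "\<dots> \<le> (64 / \<sigma>\<^sup>2 * ((real n + 1) / 2) / cmod z) * (A * cmod z powr (-a))"
    proof (rule mult_mono)
      show "(\<Sum>q<n. cmod (\<rho> q)) \<le> 64 / \<sigma>\<^sup>2 * ((real n + 1) / 2) / cmod z"
        using \<rho> z0 by (simp only: pos_le_divide_eq mult.commute)
    qed (use bound[OF zw] in \<open>auto simp: sum_nonneg\<close>)
    also have "\<dots> = B / cmod z powr (1 + a)"
      using z0 by (simp add: B_def powr_add powr_minus field_simps)
    finally show "cmod (\<Sum>k<n. \<psi> k z / (z - of_real (\<mu> k))) \<le> B / cmod z powr (1 + a)" .
  qed auto
  also have "(\<Sum>k<n. \<psi> k (of_real (\<mu> k))) = (\<Sum>q<n. \<Sum>s\<in>I. e q s * V q s)"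
    unfolding \<psi>_def V_def sum_distrib_left
    by (subst sum.swap, rule sum.cong[OF refl], subst sum.swap) (simp add: mult_ac)
  also have "\<dots> = of_real (\<Sum>q<n. \<Sum>s\<in>I. cmod (V q s))" by (simp add: e)
  also have "cmod \<dots> = (\<Sum>q<n. \<Sum>s\<in>I. cmod (V q s))" unfolding norm_of_real by (simp add: sum_nonneg)
  finally show ?thesis unfolding V_def S_def \<mu>_def B_def by (simp add: field_simps)
qed

text \<open>One variable is removed at a time: with the last variable frozen at a point \<open>z\<close> of the wedge,
  \<open>F\<close> satisfies the hypotheses in the remaining variables with \<open>A * cmod z powr (-a)\<close> for
  \<open>A\<close>. This works because the assumed bound is a product over the variables.\<close>

lemma multivariate_kernel_bound:
  fixes F :: "(nat \<Rightarrow> complex) \<Rightarrow> complex"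
  assumes \<sigma>: "0 < \<sigma>" "\<sigma> \<le> 1" and a: "0 < a" "a \<le> 1"
    and "\<And>j. j \<in> {1..m} \<Longrightarrow> 0 < \<beta> j" and "0 \<le> A"
    and "\<And>x. (\<And>j. j \<in> {1..m} \<Longrightarrow> x j \<in> wedge \<sigma>) \<Longrightarrow> cmod (F x) \<le> A * (\<Prod>j=1..m. cmod (x j) powr (-a))"
    and "\<And>x j. (\<And>j. j \<in> {1..m} \<Longrightarrow> x j \<in> wedge \<sigma>) \<Longrightarrow> j \<in> {1..m} \<Longrightarrow> (\<lambda>z. F (x(j := z))) holomorphic_on wedge \<sigma>"
    and "r < grid_dim m N"
  shows "(\<Sum>s<grid_dim m N. cmod (\<Sum>k<grid_dim m N. of_real (tensor_sine N m r k * tensor_sine N m k s) * F (spectral_point N \<beta> m k)))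
    \<le> A * (\<Prod>j=1..m. 64 / (\<sigma>\<^sup>2 * a) * \<beta> j powr (-a)) * mode_weight N m"
  using assms(5-)
proof (induction m arbitrary: F A r)
  case 0
  then show ?case by (simp add: mode_weight_def)
next
  case (Suc m)
  note \<beta> = Suc.prems(1) and A = Suc.prems(2) and bound = Suc.prems(3) and hol = Suc.prems(4) and r = Suc.prems(5)
  define n where "n = N (Suc m)"
  define d where "d = grid_dim m N"
  define b where "b = \<beta> (Suc m)"
  define C where "C = (\<Prod>j=1..m. 64 / (\<sigma>\<^sup>2 * a) * \<beta> j powr (-a)) * mode_weight N m"
  have rnd: "r < n * d" using r by (simp add: n_def d_def)
  then have d0: "d > 0" by (auto intro: gr0I)
  have r1: "r div d < n" and r2: "r mod d < d" using rnd d0 by (simp_all add: less_mult_imp_div_less)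
  have b: "0 < b" using \<beta> by (simp add: b_def)
  define H where "H = (\<lambda>s z. \<Sum>k<d. of_real (tensor_sine N m (r mod d) k * tensor_sine N m k s) * F ((spectral_point N \<beta> m k)(Suc m := z)))"
  have C0: "0 \<le> C" using \<sigma> a unfolding C_def mode_weight_def by (intro mult_nonneg_nonneg prod_nonneg) auto
  have Hbound: "(\<Sum>s<d. cmod (H s z)) \<le> A * C * cmod z powr (-a)" if z: "z \<in> wedge \<sigma>" for z
  proof -
    have "(\<Sum>s<d. cmod (H s z)) \<le> (A * cmod z powr (-a)) * (\<Prod>j=1..m. 64 / (\<sigma>\<^sup>2 * a) * \<beta> j powr (-a)) * mode_weight N m"
      unfolding H_def d_def
    proof (rule Suc.IH[of "A * cmod z powr (-a)" "\<lambda>x. F (x(Suc m := z))"])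
      fix x :: "nat \<Rightarrow> complex" assume x: "\<And>j. j \<in> {1..m} \<Longrightarrow> x j \<in> wedge \<sigma>"
      have x': "(x(Suc m := z)) j \<in> wedge \<sigma>" if "j \<in> {1..Suc m}" for j using that x z by auto
      have "cmod (F (x(Suc m := z))) \<le> A * (\<Prod>j=1..Suc m. cmod ((x(Suc m := z)) j) powr (-a))"
        by (rule bound) (rule x')
      also have "(\<Prod>j=1..Suc m. cmod ((x(Suc m := z)) j) powr (-a)) = (\<Prod>j=1..m. cmod (x j) powr (-a)) * cmod z powr (-a)"
        by (simp add: prod.nat_ivl_Suc')
      finally show "cmod (F (x(Suc m := z))) \<le> A * cmod z powr (-a) * (\<Prod>j=1..m. cmod (x j) powr (-a))"
        by (simp only: mult_ac)
      fix j assume j: "j \<in> {1..m}"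
      have "(\<lambda>w. F ((x(Suc m := z))(j := w))) holomorphic_on wedge \<sigma>"
        by (rule hol) (use x' j in auto)
      then show "(\<lambda>w. F ((x(j := w))(Suc m := z))) holomorphic_on wedge \<sigma>"
        using j by (simp add: fun_upd_twist)
    qed (use \<beta> A r2 in \<open>auto simp: d_def\<close>)
    then show ?thesis by (simp add: C_def mult_ac)
  qed
  have Hhol: "H s holomorphic_on wedge \<sigma>" for s
    unfolding H_def
  proof (intro holomorphic_intros)
    fix k assume k: "k \<in> {..<d}"
    \<comment> \<open>Coordinate \<open>Suc m\<close> of the spectral point is the default \<open>0\<close>, outside the wedge; \<open>1\<close> is inside.\<close>
    have "(\<lambda>z. F (((spectral_point N \<beta> m k)(Suc m := 1))(Suc m := z))) holomorphic_on wedge \<sigma>"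
    proof (rule hol)
      fix j assume "j \<in> {1..Suc m}"
      then show "((spectral_point N \<beta> m k)(Suc m := 1)) j \<in> wedge \<sigma>"
        using spectral_point_wedge[of k m N j \<beta> \<sigma>] k \<beta> \<sigma> by (cases "j = Suc m") (auto simp: d_def wedge_def)
    qed simp
    then show "(\<lambda>z. F ((spectral_point N \<beta> m k)(Suc m := z))) holomorphic_on wedge \<sigma>" by simp
  qed
  have split: "(\<Sum>k<n * d. of_real (tensor_sine N (Suc m) r k * tensor_sine N (Suc m) k s) * F (spectral_point N \<beta> (Suc m) k))
     = (\<Sum>k<n. of_real (sine n (int (r div d) + 1) k * sine n (int k + 1) (s div d)) * H (s mod d) (of_real (b * lap_eig n k)))" for s
  proof -
    have "(\<Sum>k<n * d. of_real (tensor_sine N (Suc m) r k * tensor_sine N (Suc m) k s) * F (spectral_point N \<beta> (Suc m) k))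
     = (\<Sum>k<n. \<Sum>l<d. of_real ((sine n (int (r div d) + 1) k * tensor_sine N m (r mod d) l) * (sine n (int k + 1) (s div d) * tensor_sine N m l (s mod d)))
          * F ((spectral_point N \<beta> m l)(Suc m := of_real (b * lap_eig n k))))"
      by (subst sum_div_mod[symmetric]) (simp only: tensor_sine.simps spectral_point.simps n_def d_def b_def)
    then show ?thesis by (simp add: H_def sum_distrib_left mult_ac)
  qed
  have "(\<Sum>s<n * d. cmod (\<Sum>k<n * d. of_real (tensor_sine N (Suc m) r k * tensor_sine N (Suc m) k s) * F (spectral_point N \<beta> (Suc m) k)))
    = (\<Sum>q<n. \<Sum>s<d. cmod (\<Sum>k<n. of_real (sine n (int (r div d) + 1) k * sine n (int k + 1) q) * H s (of_real (b * lap_eig n k))))"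
    unfolding split by (rule sum_div_mod)
  also have "\<dots> \<le> A * C * (64 / (\<sigma>\<^sup>2 * a) * b powr (-a)) * ((real n + 1) / 2)"
    by (rule tensor_resolvent_step[OF \<sigma> a b r1 _ _ Hhol Hbound]) (use A C0 in auto)
  also have "\<dots> = A * (\<Prod>j=1..Suc m. 64 / (\<sigma>\<^sup>2 * a) * \<beta> j powr (-a)) * mode_weight N (Suc m)"
    by (simp add: C_def mode_weight_def prod.nat_ivl_Suc' b_def n_def mult_ac)
  finally show ?case by (simp only: grid_dim_Suc n_def[symmetric] d_def[symmetric])
qed


section \<open>Diagonalisation of the diffusion matrices\<close>

text \<open>The second difference at a grid point reaches to both boundary points, where the sines
  vanish.\<close>

lemma sine_orthogonal_extended:
  assumes "0 \<le> x" "x \<le> int N + 1" "s < N"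
  shows "(\<Sum>k<N. sine N x k * sine N (int s + 1) k) = (if x = int s + 1 then (real N + 1) / 2 else 0)"
proof (cases "x = 0 \<or> x = int N + 1")
  case True
  then show ?thesis using assms by auto
next
  case False
  then have x: "x = int (nat (x - 1)) + 1" "nat (x - 1) < N" using assms by auto
  then have "(\<Sum>k<N. sine N x k * sine N (int s + 1) k) = (if nat (x - 1) = s then (real N + 1) / 2 else 0)"
    using sine_orthogonal[OF x(2) assms(3)] by metis
  moreover have "nat (x - 1) = s \<longleftrightarrow> x = int s + 1" using False assms by auto
  ultimately show ?thesis by simp
qed

text \<open>Apply the eigenvalue equation under the sum over the modes; orthogonality then turns the three shifted
  sines into the three diagonals.\<close>

lemma laplace_1d_spectral:
  assumes r: "r < N" and s: "s < N"
  shows "laplace_1d N $$ (r, s) =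
    (\<Sum>k<N. of_real (sine N (int r + 1) k * sine N (int k + 1) s) * - of_real (lap_eig N k)) / of_real ((real N + 1) / 2)"
proof -
  define h2 where "h2 = (real (N + 1))\<^sup>2"
  define w where "w = (real N + 1) / 2"
  define c where "c = (\<lambda>x. \<Sum>k<N. sine N x k * sine N (int s + 1) k)"
  have c: "c x = (if x = int s + 1 then w else 0)" if "0 \<le> x" "x \<le> int N + 1" for x
    unfolding c_def w_def by (rule sine_orthogonal_extended[OF that s])
  have "(\<Sum>k<N. sine N (int r + 1) k * sine N (int k + 1) s * - lap_eig N k)
     = (\<Sum>k<N. - (lap_eig N k * sine N (int r + 1) k) * sine N (int s + 1) k)"
    by (simp add: sine_commute[of N s] mult_ac)
  also have "\<dots> = (\<Sum>k<N. - h2 * (2 * (sine N (int r + 1) k * sine N (int s + 1) k)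
      - sine N (int r + 1 + 1) k * sine N (int s + 1) k - sine N (int r + 1 - 1) k * sine N (int s + 1) k))"
    unfolding second_difference_sine[symmetric] h2_def by (simp add: algebra_simps)
  also have "\<dots> = - h2 * (2 * c (int r + 1) - c (int r + 1 + 1) - c (int r + 1 - 1))"
    unfolding sum_distrib_left[symmetric] sum_subtractf c_def ..
  also have "\<dots> = (if r = s then - 2 * h2 else if r = Suc s \<or> s = Suc r then h2 else 0) * w"
    using r s by (simp add: c)
  finally have "(\<Sum>k<N. of_real (sine N (int r + 1) k * sine N (int k + 1) s) * - complex_of_real (lap_eig N k))
     = of_real ((if r = s then - 2 * h2 else if r = Suc s \<or> s = Suc r then h2 else 0) * w)"
    by (metis (no_types, lifting) of_real_minus of_real_mult of_real_sum sum.cong)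
  moreover have "w \<noteq> 0" by (simp add: w_def add_nonneg_eq_0_iff)
  moreover have "laplace_1d N $$ (r, s) = of_real (if r = s then - 2 * h2 else if r = Suc s \<or> s = Suc r then h2 else 0)"
    using r s by (simp add: laplace_1d_def mesh_width_def h2_def power_one_over divide_simps add.commute)
  ultimately show ?thesis unfolding w_def[symmetric] by simp
qed

lemma one_mat_spectral:
  assumes "r < N" "s < N"
  shows "(1\<^sub>m N :: complex mat) $$ (r, s) =
    (\<Sum>k<N. of_real (sine N (int r + 1) k * sine N (int k + 1) s) * 1) / of_real ((real N + 1) / 2)"
proof -
  have "(\<Sum>k<N. complex_of_real (sine N (int r + 1) k * sine N (int k + 1) s)) = of_real (if r = s then (real N + 1) / 2 else 0)"
    unfolding sine_orthogonal[OF assms, symmetric] of_real_sum by (simp only: sine_commute[of N s])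
  moreover have "(real N + 1) / 2 \<noteq> 0" by (simp add: add_nonneg_eq_0_iff)
  ultimately show ?thesis using assms by (simp del: of_real_divide)
qed

text \<open>The eigenvalues of a Kronecker product of matrices with eigenvalues \<open>g i\<close>, in the order used by
  \<^const>\<open>tensor_sine\<close>.\<close>

fun tensor_value :: "(nat \<Rightarrow> nat \<Rightarrow> complex) \<Rightarrow> (nat \<Rightarrow> nat) \<Rightarrow> nat \<Rightarrow> nat \<Rightarrow> complex" where
  "tensor_value g N 0 k = 1"
| "tensor_value g N (Suc m) k = g (Suc m) (k div grid_dim m N) * tensor_value g N m (k mod grid_dim m N)"

lemma kronecker_upto_spectral:
  assumes "\<And>i. i \<in> {1..m} \<Longrightarrow> F i \<in> carrier_mat (N i) (N i)"
    and "\<And>i r s. i \<in> {1..m} \<Longrightarrow> r < N i \<Longrightarrow> s < N i \<Longrightarrow> F i $$ (r, s) =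
      (\<Sum>k<N i. of_real (sine (N i) (int r + 1) k * sine (N i) (int k + 1) s) * g i k) / of_real ((real (N i) + 1) / 2)"
  shows "kronecker_upto F m \<in> carrier_mat (grid_dim m N) (grid_dim m N) \<and>
    (\<forall>r<grid_dim m N. \<forall>s<grid_dim m N. kronecker_upto F m $$ (r, s) =
      (\<Sum>k<grid_dim m N. of_real (tensor_sine N m r k * tensor_sine N m k s) * tensor_value g N m k) / of_real (mode_weight N m))"
  using assms
proof (induction m)
  case 0
  then show ?case by (simp add: mode_weight_def)
next
  case (Suc m)
  define n where "n = N (Suc m)"
  define d where "d = grid_dim m N"
  define w where "w = complex_of_real ((real n + 1) / 2)"
  have IH: "kronecker_upto F m \<in> carrier_mat d d"
    "\<And>r s. r < d \<Longrightarrow> s < d \<Longrightarrow> kronecker_upto F m $$ (r, s) =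
      (\<Sum>k<d. of_real (tensor_sine N m r k * tensor_sine N m k s) * tensor_value g N m k) / of_real (mode_weight N m)"
    using Suc.IH Suc.prems unfolding d_def by auto
  have F: "F (Suc m) \<in> carrier_mat n n"
    "\<And>r s. r < n \<Longrightarrow> s < n \<Longrightarrow> F (Suc m) $$ (r, s) = (\<Sum>k<n. of_real (sine n (int r + 1) k * sine n (int k + 1) s) * g (Suc m) k) / w"
    using Suc.prems[of "Suc m"] by (auto simp: n_def w_def)
  have w: "of_real (mode_weight N (Suc m)) = w * of_real (mode_weight N m)"
    by (simp add: mode_weight_def w_def n_def prod.nat_ivl_Suc')
  note dims = carrier_matD[OF F(1)] carrier_matD[OF IH(1)]
  have "kronecker_upto F (Suc m) \<in> carrier_mat (n * d) (n * d)"
    unfolding kronecker_upto.simps kronecker_def dims by (rule mat_carrier)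
  moreover have "kronecker_upto F (Suc m) $$ (r, s) =
      (\<Sum>k<n * d. of_real (tensor_sine N (Suc m) r k * tensor_sine N (Suc m) k s) * tensor_value g N (Suc m) k) / of_real (mode_weight N (Suc m))"
    if rs: "r < n * d" "s < n * d" for r s
  proof -
    have d: "d > 0" using rs by (auto intro: gr0I)
    have "kronecker_upto F (Suc m) $$ (r, s) = F (Suc m) $$ (r div d, s div d) * kronecker_upto F m $$ (r mod d, s mod d)"
      unfolding kronecker_upto.simps kronecker_def dims using rs by simp
    also have "\<dots> = (\<Sum>i<n. \<Sum>j<d. of_real ((sine n (int (r div d) + 1) i * tensor_sine N m (r mod d) j) * (sine n (int i + 1) (s div d) * tensor_sine N m j (s mod d)))
        * (g (Suc m) i * tensor_value g N m j)) / (w * of_real (mode_weight N m))"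
    proof -
      have "r div d < n" "s div d < n" "r mod d < d" "s mod d < d"
        using rs d by (simp_all add: less_mult_imp_div_less)
      then show ?thesis
        by (simp only: F(2) IH(2) times_divide_times_eq sum_product) (simp only: of_real_mult mult_ac)
    qed
    also have "(\<Sum>i<n. \<Sum>j<d. of_real ((sine n (int (r div d) + 1) i * tensor_sine N m (r mod d) j) * (sine n (int i + 1) (s div d) * tensor_sine N m j (s mod d)))
        * (g (Suc m) i * tensor_value g N m j)) =
      (\<Sum>k<n * d. of_real (tensor_sine N (Suc m) r k * tensor_sine N (Suc m) k s) * tensor_value g N (Suc m) k)"
      by (subst sum_div_mod[symmetric]) (simp only: tensor_sine.simps tensor_value.simps n_def d_def)
    finally show ?thesis unfolding w .
  qed
  ultimately show ?case by (simp only: grid_dim_Suc n_def[symmetric] d_def[symmetric]) blast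
qed

lemma tensor_value_direction:
  "tensor_value (\<lambda>i k. if i = j then - of_real (lap_eig (N i) k) else 1) N m k =
    (if j \<in> {1..m} then - spectral_point N (\<lambda>_. 1) m k j else 1)"
  by (induction m arbitrary: k) auto

lemma spectral_point_scale: 
  "j \<in> {1..m} \<Longrightarrow> spectral_point N \<beta> m k j = of_real (\<beta> j) * spectral_point N (\<lambda>_. 1) m k j"
  by (induction m arbitrary: k) auto

lemma mode_weight_pos: "0 < mode_weight N m"
  unfolding mode_weight_def by (intro prod_pos) (simp add: add_nonneg_pos)

lemma diffusion_dir_spectral:
  assumes "j \<in> {1..m}"
  shows "diffusion_dir m N \<beta> j \<in> carrier_mat (grid_dim m N) (grid_dim m N)"
    and "r < grid_dim m N \<Longrightarrow> s < grid_dim m N \<Longrightarrow> diffusion_dir m N \<beta> j $$ (r, s) =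
      (\<Sum>k<grid_dim m N. of_real (tensor_sine N m r k * tensor_sine N m k s) * - spectral_point N \<beta> m k j) / of_real (mode_weight N m)"
proof -
  define F where "F = (\<lambda>i. if i = j then laplace_1d (N i) else 1\<^sub>m (N i))"
  have *: "kronecker_upto F m \<in> carrier_mat (grid_dim m N) (grid_dim m N) \<and>
    (\<forall>r<grid_dim m N. \<forall>s<grid_dim m N. kronecker_upto F m $$ (r, s) =
      (\<Sum>k<grid_dim m N. of_real (tensor_sine N m r k * tensor_sine N m k s)
        * tensor_value (\<lambda>i k. if i = j then - of_real (lap_eig (N i) k) else 1) N m k) / of_real (mode_weight N m))"
  proof (rule kronecker_upto_spectral)
    fix i r s assume "i \<in> {1..m}" and rs: "r < N i" "s < N i"
    show "F i $$ (r, s) = (\<Sum>k<N i. of_real (sine (N i) (int r + 1) k * sine (N i) (int k + 1) s)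
       * (if i = j then - of_real (lap_eig (N i) k) else 1)) / of_real ((real (N i) + 1) / 2)"
      unfolding F_def using laplace_1d_spectral[OF rs] one_mat_spectral[OF rs] by (cases "i = j") simp_all
  qed (auto simp: F_def laplace_1d_def)
  have D: "diffusion_dir m N \<beta> j = complex_of_real (\<beta> j) \<cdot>\<^sub>m kronecker_upto F m"
    by (simp add: diffusion_dir_def F_def)
  show "diffusion_dir m N \<beta> j \<in> carrier_mat (grid_dim m N) (grid_dim m N)"
    unfolding D using * by auto
  assume "r < grid_dim m N" "s < grid_dim m N"
  then have "diffusion_dir m N \<beta> j $$ (r, s) = of_real (\<beta> j) * ((\<Sum>k<grid_dim m N. of_real (tensor_sine N m r k * tensor_sine N m k s)
        * (- spectral_point N (\<lambda>_. 1) m k j)) / of_real (mode_weight N m))"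
    unfolding D using * assms by (auto simp: tensor_value_direction)
  then show "diffusion_dir m N \<beta> j $$ (r, s) =
      (\<Sum>k<grid_dim m N. of_real (tensor_sine N m r k * tensor_sine N m k s) * - spectral_point N \<beta> m k j) / of_real (mode_weight N m)"
    unfolding spectral_point_scale[OF assms, of N \<beta>] by (simp add: sum_distrib_left mult_ac)
qed

section \<open>Functional calculus for diagonalisable matrices\<close>

text \<open>Everything that is computed from matrices which are diagonal in a common basis is diagonal in this
  basis; so identities between them reduce to identities between functions on the spectrum.\<close>

locale diagonalisation =
  fixes d :: nat and S S' :: "complex mat"
  assumes carrier [simp, intro]: "S \<in> carrier_mat d d" "S' \<in> carrier_mat d d"
    and inverse: "S * S' = 1\<^sub>m d" "S' * S = 1\<^sub>m d"
begin

definition calc :: "(nat \<Rightarrow> complex) \<Rightarrow> complex mat" where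
  "calc f = S * mat_diag d f * S'"

lemma product_carrier [simp, intro]:
  "A \<in> carrier_mat d d \<Longrightarrow> B \<in> carrier_mat d d \<Longrightarrow> A * B \<in> carrier_mat d d"
  by (rule mult_carrier_mat)

lemma calc_carrier [simp, intro]: "calc f \<in> carrier_mat d d"
  by (simp add: calc_def)

lemma calc_dim [simp]: "dim_row (calc f) = d" "dim_col (calc f) = d"
  using calc_carrier carrier_matD by blast+

lemma calc_entry:
  assumes "r < d" "s < d"
  shows "calc f $$ (r, s) = (\<Sum>k<d. S $$ (r, k) * f k * S' $$ (k, s))"
  using assms carrier_matD[OF carrier(1)] carrier_matD[OF carrier(2)]
  by (simp add: calc_def mat_diag_mult_right[OF carrier(1)] scalar_prod_def atLeast0LessThan)

lemma calc_cong: "(\<And>k. k < d \<Longrightarrow> f k = g k) \<Longrightarrow> calc f = calc g"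
  by (intro eq_matI) (auto simp: calc_entry)

lemma calc_eqI:
  assumes "A \<in> carrier_mat d d"
    and "\<And>r s. r < d \<Longrightarrow> s < d \<Longrightarrow> A $$ (r, s) = (\<Sum>k<d. S $$ (r, k) * f k * S' $$ (k, s))"
  shows "A = calc f"
  using assms by (intro eq_matI) (auto simp: calc_entry)

lemma calc_one: "calc (\<lambda>_. 1) = 1\<^sub>m d"
  using right_mult_one_mat[OF carrier(1)] by (simp add: calc_def inverse)

lemma calc_mult: "calc f * calc g = calc (\<lambda>k. f k * g k)"
proof -
  have "calc f * calc g = S * mat_diag d f * (S' * (S * mat_diag d g * S'))"
    unfolding calc_def by (rule assoc_mult_mat[of _ d d _ d _ d]) auto
  also have "S' * (S * mat_diag d g * S') = S' * (S * (mat_diag d g * S'))"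
    by (subst assoc_mult_mat[of S d d _ d _ d]) auto
  also have "\<dots> = S' * S * (mat_diag d g * S')"
    by (subst assoc_mult_mat[of S' d d S d _ d]) auto
  also have "\<dots> = mat_diag d g * S'" unfolding inverse by (rule left_mult_one_mat) auto
  also have "S * mat_diag d f * (mat_diag d g * S') = S * (mat_diag d f * mat_diag d g) * S'"
    by (simp add: assoc_mult_mat[of _ d d _ d _ d] del: mat_diag_diag)
  finally show ?thesis by (simp add: calc_def)
qed

lemma calc_pow: "calc f ^\<^sub>m n = calc (\<lambda>k. f k ^ n)"
  by (induction n) (simp_all add: calc_one calc_mult mult.commute)

lemma calc_smult: "c \<cdot>\<^sub>m calc f = calc (\<lambda>k. c * f k)"
  by (intro calc_eqI) (auto simp: calc_entry sum_distrib_left mult_ac)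

lemma calc_finsum:
  assumes "\<And>a. a \<in> I \<Longrightarrow> A a = calc (f a)"
  shows "finsum_sqmat d A I = calc (\<lambda>k. \<Sum>a\<in>I. f a k)"
proof (rule calc_eqI)
  fix r s assume rs: "r < d" "s < d"
  then have "finsum_sqmat d A I $$ (r, s) = (\<Sum>a\<in>I. \<Sum>k<d. S $$ (r, k) * f a k * S' $$ (k, s))"
    by (simp add: finsum_sqmat_def assms calc_entry)
  also have "\<dots> = (\<Sum>k<d. S $$ (r, k) * (\<Sum>a\<in>I. f a k) * S' $$ (k, s))"
    unfolding sum_distrib_left sum_distrib_right by (rule sum.swap)
  finally show "finsum_sqmat d A I $$ (r, s) = (\<Sum>k<d. S $$ (r, k) * (\<Sum>a\<in>I. f a k) * S' $$ (k, s))" .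
qed (simp add: finsum_sqmat_def)

lemma calc_invertible:
  assumes "\<And>k. k < d \<Longrightarrow> f k \<noteq> 0"
  shows "invertible_mat (calc f)" and "inv_of_mat (calc f) = calc (\<lambda>k. inverse (f k))"
proof -
  have 1: "calc f * calc (\<lambda>k. inverse (f k)) = 1\<^sub>m d" "calc (\<lambda>k. inverse (f k)) * calc f = 1\<^sub>m d"
    unfolding calc_mult calc_one[symmetric] by (auto intro!: calc_cong simp: assms)
  then show "invertible_mat (calc f)"
    unfolding invertible_mat_def inverts_mat_def square_mat.simps by (metis calc_dim)
  have "calc f \<in> Units (ring_mat TYPE(complex) d ())"
    unfolding Units_def ring_mat_simps using 1 by auto
  then obtain B where B: "mat_inverse (calc f) = Some B"
    using mat_inverse(1)[OF calc_carrier, of f "()"] by (cases "mat_inverse (calc f)") auto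
  then have B': "calc f * B = 1\<^sub>m d" "B \<in> carrier_mat d d" using mat_inverse(2)[OF calc_carrier] by auto
  have "B = (calc (\<lambda>k. inverse (f k)) * calc f) * B" unfolding 1 using B' by simp
  also have "\<dots> = calc (\<lambda>k. inverse (f k)) * (calc f * B)"
    by (rule assoc_mult_mat[of _ d d _ d _ d]) (use B' in auto)
  also have "\<dots> = calc (\<lambda>k. inverse (f k))" unfolding B' by (rule right_mult_one_mat) auto
  finally show "inv_of_mat (calc f) = calc (\<lambda>k. inverse (f k))" by (simp add: inv_of_mat_def B)
qed

lemma calc_monomial:
  assumes "\<And>i. i \<in> Poly_Mapping.keys a \<Longrightarrow> X i = calc (x i)"
  shows "monomial_eval_mat d X a = calc (\<lambda>k. \<Prod>i\<in>Poly_Mapping.keys a. x i k ^ Poly_Mapping.lookup a i)"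
proof -
  have "foldr (\<lambda>i M. X i ^\<^sub>m Poly_Mapping.lookup a i * M) is (1\<^sub>m d) = calc (\<lambda>k. \<Prod>i\<leftarrow>is. x i k ^ Poly_Mapping.lookup a i)"
    if "set is \<subseteq> Poly_Mapping.keys a" for "is"
    using that by (induction "is") (auto simp: calc_one assms calc_pow calc_mult)
  then show ?thesis unfolding monomial_eval_mat_def
    by (simp add: prod.distinct_set_conv_list[symmetric])
qed

lemma calc_cmpoly:
  assumes "\<And>i. i \<in> cmpoly_vars p \<Longrightarrow> X i = calc (x i)"
  shows "cmpoly_eval_mat d X p = calc (\<lambda>k. cmpoly_eval (\<lambda>i. x i k) p)"
  unfolding cmpoly_eval_mat_def cmpoly_eval_def
proof (rule calc_finsum)
  fix a assume "a \<in> Poly_Mapping.keys p"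
  then have "monomial_eval_mat d X a = calc (\<lambda>k. \<Prod>i\<in>Poly_Mapping.keys a. x i k ^ Poly_Mapping.lookup a i)"
    by (intro calc_monomial assms) (auto simp: cmpoly_vars_def)
  then show "Poly_Mapping.lookup p a \<cdot>\<^sub>m monomial_eval_mat d X a =
     calc (\<lambda>k. Poly_Mapping.lookup p a * (\<Prod>i\<in>Poly_Mapping.keys a. x i k ^ Poly_Mapping.lookup a i))"
    by (simp add: calc_smult)
qed

end

section \<open>The bound for the diffusion matrices\<close>

lemma max_norm_mat_le:
  assumes A: "A \<in> carrier_mat d d" and d: "0 < d"
    and row: "\<And>r. r < d \<Longrightarrow> (\<Sum>s<d. cmod (A $$ (r, s))) \<le> C"
  shows "max_norm_mat A \<le> C"
  unfolding max_norm_mat_def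
proof (rule cSUP_least)
  have dc: "dim_col A = d" "dim_row A = d" using A by auto
  define u :: "complex Matrix.vec" where "u = unit_vec d 0"
  have "u $ 0 \<noteq> 0\<^sub>v d $ 0" using d by (simp add: u_def)
  then have "u \<in> carrier_vec (dim_col A) - {0\<^sub>v (dim_col A)}" unfolding dc by (auto simp: u_def)
  then show "carrier_vec (dim_col A) - {0\<^sub>v (dim_col A) :: complex Matrix.vec} \<noteq> {}" by (metis empty_iff)
  fix v :: "complex Matrix.vec" assume "v \<in> carrier_vec (dim_col A) - {0\<^sub>v (dim_col A)}"
  then have v: "v \<in> carrier_vec d" and v0: "v \<noteq> 0\<^sub>v d" by (auto simp: dc)
  have le: "cmod (v $ i) \<le> max_norm_vec v" if "i < d" for i
    unfolding max_norm_vec_def using that v by (intro Max_ge) auto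
  obtain i where i: "i < d" "v $ i \<noteq> 0" using v v0 by (auto simp: Matrix.vec_eq_iff)
  have pos: "max_norm_vec v > 0" using le[OF i(1)] i(2) by (metis norm_le_zero_iff not_le order_trans)
  have "max_norm_vec (A *\<^sub>v v) \<le> C * max_norm_vec v"
    unfolding max_norm_vec_def[of "A *\<^sub>v v"]
  proof (rule Max.boundedI)
    fix x assume "x \<in> (\<lambda>i. cmod ((A *\<^sub>v v) $ i)) ` {..<dim_vec (A *\<^sub>v v)}"
    then obtain r where r: "r < d" and x: "x = cmod ((A *\<^sub>v v) $ r)" using dc by auto
    have "(A *\<^sub>v v) $ r = (\<Sum>s<d. A $$ (r, s) * v $ s)"
      using r dc v by (simp add: scalar_prod_def atLeast0LessThan)
    then have "x \<le> (\<Sum>s<d. cmod (A $$ (r, s)) * max_norm_vec v)"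
      unfolding x by (auto intro!: sum_norm_le mult_left_mono le simp: norm_mult)
    also have "\<dots> \<le> C * max_norm_vec v"
      unfolding sum_distrib_right[symmetric] using row[OF r] pos by (intro mult_right_mono) auto
    finally show "x \<le> C * max_norm_vec v" .
  qed (use d dc in auto)
  then show "max_norm_vec (A *\<^sub>v v) / max_norm_vec v \<le> C" using pos by (simp add: pos_divide_le_eq)
qed

text \<open>The matrix of tensor sines is symmetric and its square is a multiple of the identity, so it is its own
  inverse up to the factor \<^const>\<open>mode_weight\<close>.\<close>

lemma tensor_sine_diagonalisation:
  defines "S \<equiv> \<lambda>N m. Matrix.mat (grid_dim m N) (grid_dim m N) (\<lambda>(r, k). complex_of_real (tensor_sine N m r k))"
  shows "diagonalisation (grid_dim m N) (S N m) ((1 / of_real (mode_weight N m)) \<cdot>\<^sub>m S N m)"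
proof -
  define d where "d = grid_dim m N"
  define c where "c = 1 / complex_of_real (mode_weight N m)"
  have orth: "(\<Sum>k<grid_dim m N. tensor_sine N m r k * tensor_sine N m k s) = (if r = s then mode_weight N m else 0)"
    if "r < grid_dim m N" "s < grid_dim m N" for m r s
    using that
  proof (induction m arbitrary: r s)
    case 0
    then show ?case by (simp add: mode_weight_def)
  next
    case (Suc m)
    let ?n = "N (Suc m)" and ?d = "grid_dim m N"
    have d: "?d > 0" using Suc.prems by (auto intro: gr0I)
    have "(\<Sum>k<grid_dim (Suc m) N. tensor_sine N (Suc m) r k * tensor_sine N (Suc m) k s)
      = (\<Sum>i<?n. \<Sum>j<?d. (sine ?n (int (r div ?d) + 1) i * tensor_sine N m (r mod ?d) j) * (sine ?n (int i + 1) (s div ?d) * tensor_sine N m j (s mod ?d)))"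
      unfolding sum_div_mod[symmetric] by simp
    also have "\<dots> = (\<Sum>i<?n. sine ?n (int (r div ?d) + 1) i * sine ?n (int (s div ?d) + 1) i) * (\<Sum>j<?d. tensor_sine N m (r mod ?d) j * tensor_sine N m j (s mod ?d))"
      unfolding sum_product by (simp only: sine_commute[of _ "s div ?d"] mult_ac)
    also have "\<dots> = (if r div ?d = s div ?d then (real ?n + 1) / 2 else 0) * (if r mod ?d = s mod ?d then mode_weight N m else 0)"
      using Suc.prems d by (subst sine_orthogonal, simp_all add: less_mult_imp_div_less Suc.IH)
    also have "\<dots> = (if r = s then mode_weight N (Suc m) else 0)"
    proof -
      have "r = s \<longleftrightarrow> r div ?d = s div ?d \<and> r mod ?d = s mod ?d"
        using div_mult_mod_eq[of r ?d] div_mult_mod_eq[of s ?d] by metis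
      moreover have "mode_weight N (Suc m) = (real ?n + 1) / 2 * mode_weight N m"
        by (simp add: mode_weight_def prod.nat_ivl_Suc')
      ultimately show ?thesis by simp
    qed
    finally show ?case .
  qed
  have S: "S N m \<in> carrier_mat d d" by (simp add: S_def d_def)
  have "S N m * S N m = of_real (mode_weight N m) \<cdot>\<^sub>m 1\<^sub>m d"
  proof (rule eq_matI)
    fix r s assume "r < dim_row (of_real (mode_weight N m) \<cdot>\<^sub>m (1\<^sub>m d :: complex mat))" "s < dim_col (of_real (mode_weight N m) \<cdot>\<^sub>m (1\<^sub>m d :: complex mat))"
    then have rs: "r < d" "s < d" by auto
    then have "(S N m * S N m) $$ (r, s) = of_real (\<Sum>k<d. tensor_sine N m r k * tensor_sine N m k s)"
      by (simp add: S_def d_def scalar_prod_def atLeast0LessThan)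
    then show "(S N m * S N m) $$ (r, s) = (of_real (mode_weight N m) \<cdot>\<^sub>m 1\<^sub>m d) $$ (r, s)"
      unfolding d_def using rs orth[of r m s] by (simp only: d_def) simp
  qed (use S in auto)
  moreover have "c * of_real (mode_weight N m) = 1" using mode_weight_pos[of N m] by (simp add: c_def)
  ultimately have "S N m * (c \<cdot>\<^sub>m S N m) = 1\<^sub>m d" "(c \<cdot>\<^sub>m S N m) * S N m = 1\<^sub>m d"
    unfolding mult_smult_distrib[OF S S] mult_smult_assoc_mat[OF S S] by (intro eq_matI; simp)+
  then show ?thesis using S by (unfold_locales) (auto simp: c_def d_def)
qed

lemma sector_of_wedge:
  assumes \<alpha>: "0 < \<alpha>" "\<alpha> \<le> pi / 4" and z: "z \<in> wedge (tan \<alpha>)" and \<tau>: "0 < \<tau>"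
  shows "- of_real \<tau> * z \<in> sector \<alpha>"
proof -
  have t: "0 < tan \<alpha>" using \<alpha> by (intro tan_gt_zero) auto
  have "0 < tan \<alpha> * Re z" using z abs_ge_zero[of "Im z"] unfolding wedge_def by simp
  then have Re: "0 < Re z" using t by (simp add: zero_less_mult_iff)
  then have "\<bar>Im z / Re z\<bar> \<le> tan \<alpha>" using z by (simp add: wedge_def abs_divide divide_le_eq)
  then have "arctan \<bar>Im z / Re z\<bar> \<le> arctan (tan \<alpha>)" by (simp only: arctan_le_iff)
  also have "arctan (tan \<alpha>) = \<alpha>" using \<alpha> by (intro arctan_tan) auto
  also have "arctan \<bar>Im z / Re z\<bar> = \<bar>arctan (Im z / Re z)\<bar>"
    by (metis abs_if arctan_less_zero_iff arctan_minus)
  finally have "\<bar>arctan (Im z / Re z)\<bar> \<le> \<alpha>" .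
  moreover have "Arg (of_real \<tau> * z) = arctan (Im z / Re z)"
    using Re \<tau> by (subst arg_conv_arctan) auto
  ultimately show ?thesis by (simp add: sector_def)
qed

text \<open>In a wedge of slope at most one, \<open>cmod (x j) \<le> 2 * Re (x j)\<close>, and real parts cannot cancel in the sum. Hence each
  \<open>cmod (x j)\<close> is at most twice the modulus of the sum, and so is their geometric mean. The geometric
  mean gives a bound in product form, as required for treating the variables one by one.\<close>

lemma resolvent_symbol_bound:
  fixes x :: "nat \<Rightarrow> complex"
  assumes "1 \<le> m" "0 < \<sigma>" "\<sigma> \<le> 1" and x: "\<And>j. j \<in> {1..m} \<Longrightarrow> x j \<in> wedge \<sigma>"
  shows "(\<Sum>j=1..m. x j) \<noteq> 0" and "1 / cmod (\<Sum>j=1..m. x j) \<le> 2 * (\<Prod>j=1..m. cmod (x j) powr (- (1 / real m)))"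
proof -
  define R where "R = (\<Sum>j=1..m. Re (x j))"
  have pos: "0 < Re (x j)" "cmod (x j) \<le> 2 * Re (x j)" if j: "j \<in> {1..m}" for j
  proof -
    have w: "\<bar>Im (x j)\<bar> < \<sigma> * Re (x j)" using x[OF j] by (simp add: wedge_def)
    then have "0 < \<sigma> * Re (x j)" by linarith
    then show p: "0 < Re (x j)" using assms(2) by (simp add: zero_less_mult_iff)
    have "\<sigma> * Re (x j) \<le> 1 * Re (x j)" using p assms by (intro mult_right_mono) auto
    then show "cmod (x j) \<le> 2 * Re (x j)" using w p cmod_le[of "x j"] by linarith
  qed
  have R: "R > 0" unfolding R_def using pos assms(1) by (intro sum_pos) auto
  have RS: "R \<le> cmod (\<Sum>j=1..m. x j)" unfolding R_def by (metis Re_sum complex_Re_le_cmod)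
  then show "(\<Sum>j=1..m. x j) \<noteq> 0" using R by auto
  define P where "P = (\<Prod>j=1..m. cmod (x j) powr (1 / real m))"
  have xp: "0 < cmod (x j)" if "j \<in> {1..m}" for j using pos[OF that] complex_Re_le_cmod[of "x j"] by linarith
  have P0: "P > 0" unfolding P_def using xp by (intro prod_pos) auto
  have "P \<le> (\<Prod>j=1..m. (2 * R) powr (1 / real m))"
    unfolding P_def
  proof (intro prod_mono conjI powr_mono2)
    fix j assume j: "j \<in> {1..m}"
    have "Re (x j) \<le> R" unfolding R_def using pos j by (intro member_le_sum) (auto intro: less_imp_le)
    then show "cmod (x j) \<le> 2 * R" using pos[OF j] by linarith
  qed auto
  also have "\<dots> = 2 * R" using R assms(1) by (simp add: powr_powr[symmetric] powr_realpow[symmetric] powr_powr)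
  finally have "P \<le> 2 * R" .
  then have "1 / R \<le> 2 / P" using R P0 by (simp add: field_simps)
  moreover have "1 / cmod (\<Sum>j=1..m. x j) \<le> 1 / R" using R RS by (intro divide_left_mono) (auto intro!: mult_pos_pos simp del: zero_less_norm_iff)
  moreover have "(\<Prod>j=1..m. cmod (x j) powr (- (1 / real m))) = 1 / P"
    unfolding P_def powr_minus using prod_inversef[of "\<lambda>j. cmod (x j) powr (1 / real m)" "{1..m}"]
    by (simp only: o_def inverse_eq_divide)
  ultimately show "1 / cmod (\<Sum>j=1..m. x j) \<le> 2 * (\<Prod>j=1..m. cmod (x j) powr (- (1 / real m)))"
    by simp
qed

lemma holomorphic_cmpoly_eval [holomorphic_intros]:
  assumes "\<And>i. (\<lambda>z. x z i) holomorphic_on A"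
  shows "(\<lambda>z. cmpoly_eval (x z) p) holomorphic_on A"
  unfolding cmpoly_eval_def by (intro holomorphic_intros assms)

theorem theorem1:
  fixes m :: nat and \<alpha> :: real
  assumes "1 \<le> m" and "0 < \<alpha>" and "\<alpha> \<le> pi / 4"
  shows "\<exists>K::real. \<forall>P Q :: cmpoly.
    cmpoly_vars P \<subseteq> {1..m} \<longrightarrow> cmpoly_vars Q \<subseteq> {1..m} \<longrightarrow>
    (\<forall>z :: nat \<Rightarrow> complex. (\<forall>j\<in>{1..m}. z j \<in> sector \<alpha>) \<longrightarrow>
       cmpoly_eval z Q \<noteq> 0 \<and> cmod (ratfun_eval z P Q) \<le> 1) \<longrightarrow>
    (\<forall>(\<beta> :: nat \<Rightarrow> real) (N :: nat \<Rightarrow> nat) (\<tau> :: real) (n :: nat).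
       (\<forall>j\<in>{1..m}. 0 < \<beta> j) \<longrightarrow> (\<forall>j\<in>{1..m}. 1 \<le> N j) \<longrightarrow> 0 < \<tau> \<longrightarrow>
       (let d = grid_dim m N;
            D = diffusion m N \<beta>;
            X = (\<lambda>j. complex_of_real \<tau> \<cdot>\<^sub>m diffusion_dir m N \<beta> j)
        in invertible_mat D \<and> invertible_mat (cmpoly_eval_mat d X Q) \<and>
           max_norm_mat (inv_of_mat D * ratfun_eval_mat d X P Q ^\<^sub>m n) \<le> K / Min (\<beta> ` {1..m})))"
proof -
  define \<sigma> where "\<sigma> = tan \<alpha>"
  define a where "a = 1 / real m"
  define C where "C = 64 / (\<sigma>\<^sup>2 * a)"
  have \<sigma>: "0 < \<sigma>" "\<sigma> \<le> 1"
    using assms tan_gt_zero[of \<alpha>] tan_mono_le[of \<alpha> "pi / 4"] pi_gt_zero by (simp_all add: \<sigma>_def tan_45)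
  have a: "0 < a" "a \<le> 1" using assms by (simp_all add: a_def)
  have C: "0 < C" using \<sigma> a by (simp add: C_def)
  show ?thesis
  proof (rule exI[of _ "2 * C ^ m"], intro allI impI)
    fix P Q :: cmpoly and \<beta> :: "nat \<Rightarrow> real" and N :: "nat \<Rightarrow> nat" and \<tau> :: real and n :: nat
    assume vars: "cmpoly_vars P \<subseteq> {1..m}" "cmpoly_vars Q \<subseteq> {1..m}"
      and R: "\<forall>z. (\<forall>j\<in>{1..m}. z j \<in> sector \<alpha>) \<longrightarrow> cmpoly_eval z Q \<noteq> 0 \<and> cmod (ratfun_eval z P Q) \<le> 1"
      and \<beta>: "\<forall>j\<in>{1..m}. 0 < \<beta> j" and N: "\<forall>j\<in>{1..m}. 1 \<le> N j" and \<tau>: "0 < \<tau>"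
    define d where "d = grid_dim m N"
    define X where "X = (\<lambda>j. complex_of_real \<tau> \<cdot>\<^sub>m diffusion_dir m N \<beta> j)"
    \<comment> \<open>Positive variables \<open>x j\<close> stand for \<open>- z j\<close>, where \<open>z j\<close> are the variables of the diffusion matrices.\<close>
    define scaled where "scaled = (\<lambda>x (j::nat). - complex_of_real \<tau> * x j)"
    \<comment> \<open>The symbol of the matrix to be bounded; the sign comes from the inverse of \<open>\<Sum>j=1..m. - x j\<close>.\<close>
    define F where "F = (\<lambda>x. - (ratfun_eval (scaled x) P Q ^ n / (\<Sum>j=1..m. x j)))"
    define S where "S = Matrix.mat d d (\<lambda>(r, k). complex_of_real (tensor_sine N m r k))"
    define w where "w = mode_weight N m"
    define S' where "S' = (1 / of_real w) \<cdot>\<^sub>m S"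
    define p where "p = spectral_point N \<beta> m"
    interpret diagonalisation d S S'
      unfolding S_def S'_def w_def d_def by (rule tensor_sine_diagonalisation)
    have d0: "0 < d" unfolding d_def grid_dim_def
    proof (rule prod_pos)
      fix j assume "j \<in> {1..m}"
      with N have "1 \<le> N j" by blast
      then show "0 < N j" by simp
    qed
    have w0: "0 < w" unfolding w_def by (rule mode_weight_pos)
    have pw: "p k j \<in> wedge \<sigma>" if "k < d" "j \<in> {1..m}" for k j
      unfolding p_def using that \<beta> \<sigma> by (intro spectral_point_wedge) (auto simp: d_def)
    have sec: "\<forall>j\<in>{1..m}. scaled x j \<in> sector \<alpha>" if "\<And>j. j \<in> {1..m} \<Longrightarrow> x j \<in> wedge \<sigma>" for x
      using that sector_of_wedge[OF assms(2,3) _ \<tau>] by (auto simp: scaled_def \<sigma>_def)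
    have entry: "S $$ (r, k) * f k * S' $$ (k, s) = of_real (tensor_sine N m r k * tensor_sine N m k s) * f k / of_real w"
      if "r < d" "k < d" "s < d" for r k s and f :: "nat \<Rightarrow> complex"
      using that by (simp add: S_def S'_def)
    have dir: "diffusion_dir m N \<beta> j = calc (\<lambda>k. - p k j)" if j: "j \<in> {1..m}" for j
    proof (rule calc_eqI)
      show "diffusion_dir m N \<beta> j \<in> carrier_mat d d" unfolding d_def by (rule diffusion_dir_spectral[OF j])
      fix r s assume rs: "r < d" "s < d"
      have "diffusion_dir m N \<beta> j $$ (r, s) = (\<Sum>k<d. of_real (tensor_sine N m r k * tensor_sine N m k s) * - p k j / of_real w)"
        using rs unfolding d_def p_def w_def sum_divide_distrib[symmetric] by (rule diffusion_dir_spectral(2)[OF j])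
      also have "\<dots> = (\<Sum>k<d. S $$ (r, k) * - p k j * S' $$ (k, s))"
        by (intro sum.cong refl entry[symmetric]) (use rs in auto)
      finally show "diffusion_dir m N \<beta> j $$ (r, s) = (\<Sum>k<d. S $$ (r, k) * - p k j * S' $$ (k, s))" .
    qed
    have D: "diffusion m N \<beta> = calc (\<lambda>k. \<Sum>j=1..m. - p k j)"
      unfolding diffusion_def d_def[symmetric] by (rule calc_finsum) (rule dir)
    have X: "X j = calc (\<lambda>k. scaled (p k) j)" if "j \<in> {1..m}" for j
      unfolding X_def dir[OF that] calc_smult by (simp add: scaled_def)
    have P': "cmpoly_eval_mat d X P = calc (\<lambda>k. cmpoly_eval (scaled (p k)) P)"
      by (rule calc_cmpoly, rule X, rule subsetD[OF vars(1)])
    have Q': "cmpoly_eval_mat d X Q = calc (\<lambda>k. cmpoly_eval (scaled (p k)) Q)"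
      by (rule calc_cmpoly, rule X, rule subsetD[OF vars(2)])
    have Q0: "cmpoly_eval (scaled (p k)) Q \<noteq> 0" if "k < d" for k
      using R sec[of "p k"] pw[OF that] by blast
    have D0: "(\<Sum>j=1..m. - p k j) \<noteq> 0" if "k < d" for k
      using resolvent_symbol_bound(1)[OF assms(1) \<sigma>, of "p k"] pw[OF that] by (simp add: sum_negf)
    have invD: "invertible_mat (diffusion m N \<beta>)" "inv_of_mat (diffusion m N \<beta>) = calc (\<lambda>k. inverse (\<Sum>j=1..m. - p k j))"
      unfolding D using D0 by (auto intro: calc_invertible)
    have invQ: "invertible_mat (cmpoly_eval_mat d X Q)"
      "inv_of_mat (cmpoly_eval_mat d X Q) = calc (\<lambda>k. inverse (cmpoly_eval (scaled (p k)) Q))"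
      unfolding Q' using Q0 by (auto intro: calc_invertible)
    have "inv_of_mat (diffusion m N \<beta>) * ratfun_eval_mat d X P Q ^\<^sub>m n = calc (\<lambda>k. F (p k))"
      unfolding ratfun_eval_mat_def P' invD(2) invQ(2) calc_mult calc_pow
      by (rule calc_cong) (simp add: F_def ratfun_eval_def divide_inverse sum_negf mult_ac)
    moreover have "max_norm_mat (calc (\<lambda>k. F (p k))) \<le> 2 * C ^ m / Min (\<beta> ` {1..m})"
    proof (rule max_norm_mat_le[OF calc_carrier d0])
      fix r assume r: "r < d"
      have "(\<Sum>s<d. cmod (calc (\<lambda>k. F (p k)) $$ (r, s))) =
        (\<Sum>s<d. cmod (\<Sum>k<d. of_real (tensor_sine N m r k * tensor_sine N m k s) * F (p k))) / w"
        unfolding sum_divide_distrib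
      proof (intro sum.cong refl)
        fix s assume s: "s \<in> {..<d}"
        have "calc (\<lambda>k. F (p k)) $$ (r, s) = (\<Sum>k<d. of_real (tensor_sine N m r k * tensor_sine N m k s) * F (p k) / of_real w)"
          unfolding calc_entry[OF r s[unfolded lessThan_iff]] by (intro sum.cong refl entry) (use r s in auto)
        also have "\<dots> = (\<Sum>k<d. of_real (tensor_sine N m r k * tensor_sine N m k s) * F (p k)) / of_real w"
          by (simp only: sum_divide_distrib)
        finally show "cmod (calc (\<lambda>k. F (p k)) $$ (r, s)) =
            cmod (\<Sum>k<d. of_real (tensor_sine N m r k * tensor_sine N m k s) * F (p k)) / w"
          using w0 by (simp only: norm_divide norm_of_real abs_of_pos)
      qed
      also have "(\<Sum>s<d. cmod (\<Sum>k<d. of_real (tensor_sine N m r k * tensor_sine N m k s) * F (p k)))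
        \<le> 2 * (\<Prod>j=1..m. 64 / (\<sigma>\<^sup>2 * a) * \<beta> j powr (-a)) * mode_weight N m"
        unfolding d_def p_def
      proof (rule multivariate_kernel_bound[OF \<sigma> a])
        fix x :: "nat \<Rightarrow> complex" assume x: "\<And>j. j \<in> {1..m} \<Longrightarrow> x j \<in> wedge \<sigma>"
        have "cmod (ratfun_eval (scaled x) P Q) \<le> 1" using R sec[of x, OF x] by blast
        then have "cmod (ratfun_eval (scaled x) P Q) ^ n \<le> 1" by (simp add: power_le_one)
        then have "cmod (F x) \<le> 1 / cmod (\<Sum>j=1..m. x j)"
          by (simp add: F_def norm_divide norm_power divide_right_mono)
        also have "\<dots> \<le> 2 * (\<Prod>j=1..m. cmod (x j) powr (-a))"
          unfolding a_def by (rule resolvent_symbol_bound(2)[OF assms(1) \<sigma>, of x, OF x])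
        finally show "cmod (F x) \<le> 2 * (\<Prod>j=1..m. cmod (x j) powr (-a))" .
        fix i assume "i \<in> {1..m}"
        have upd: "(x(i := z)) j \<in> wedge \<sigma>" if "z \<in> wedge \<sigma>" "j \<in> {1..m}" for z j using that x by auto
        have "cmpoly_eval (scaled (x(i := z))) Q \<noteq> 0" "(\<Sum>j=1..m. (x(i := z)) j) \<noteq> 0" if "z \<in> wedge \<sigma>" for z
          using R sec[of "x(i := z)", OF upd[OF that]] resolvent_symbol_bound(1)[OF assms(1) \<sigma>, of "x(i := z)", OF upd[OF that]] by blast+
        moreover have "(\<lambda>z. (x(i := z)) j) holomorphic_on wedge \<sigma>" for j
          by (cases "j = i") (auto intro: holomorphic_intros)
        ultimately show "(\<lambda>z. F (x(i := z))) holomorphic_on wedge \<sigma>"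
          unfolding F_def ratfun_eval_def by (intro holomorphic_intros) (auto simp: scaled_def intro!: holomorphic_intros)
      qed (use \<beta> r in \<open>auto simp: d_def\<close>)
      also have "2 * (\<Prod>j=1..m. 64 / (\<sigma>\<^sup>2 * a) * \<beta> j powr (-a)) * mode_weight N m / w = 2 * (C ^ m * (\<Prod>j=1..m. \<beta> j powr (-a)))"
        using w0 by (simp add: w_def C_def[symmetric] prod.distrib)
      also have "\<dots> \<le> 2 * (C ^ m * (1 / Min (\<beta> ` {1..m})))"
      proof -
        define b where "b = Min (\<beta> ` {1..m})"
        have "b \<in> \<beta> ` {1..m}" unfolding b_def using assms(1) by (intro Min_in) auto
        then have b: "0 < b" using \<beta> by auto
        have "(\<Prod>j=1..m. \<beta> j powr (-a)) \<le> (\<Prod>j=1..m. b powr (-a))"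
          using b a by (intro prod_mono conjI powr_mono2') (auto simp: b_def)
        also have "\<dots> = 1 / b"
          using b assms(1) by (simp add: a_def powr_minus powr_realpow[symmetric] powr_powr field_simps)
        finally show ?thesis unfolding b_def using C by (intro mult_left_mono) auto
      qed
      finally show "(\<Sum>s<d. cmod (calc (\<lambda>k. F (p k)) $$ (r, s))) \<le> 2 * C ^ m / Min (\<beta> ` {1..m})"
        using w0 by (simp add: divide_right_mono)
    qed
    ultimately show "let d = grid_dim m N; D = diffusion m N \<beta>; X = (\<lambda>j. complex_of_real \<tau> \<cdot>\<^sub>m diffusion_dir m N \<beta> j)
        in invertible_mat D \<and> invertible_mat (cmpoly_eval_mat d X Q) \<and>
           max_norm_mat (inv_of_mat D * ratfun_eval_mat d X P Q ^\<^sub>m n) \<le> 2 * C ^ m / Min (\<beta> ` {1..m})"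
      unfolding Let_def d_def[symmetric] X_def[symmetric] using invD(1) invQ(1) by simp
  qed
qed

end
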